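(* Let $\Sigma$ be a detector surface, $\varepsilon>0$, and let $(f,\alpha_1,\rho_1)$ be as in the context, i.e. $\Sigma$ encloses the compact support of $f$, and assume $\operatorname{supp}\alpha_1\cup\operatorname{supp}\rho_1\subsetneq\operatorname{int}(\operatorname{supp}f)$. Suppose that the data $M_{0,x}$ and $N_{\infty,x}$ are given for all $x\in\Sigma$. Then the three-dimensional X-ray transform $X_3[\varepsilon\alpha_1](y,v)$ is known for all $y\in\mathbb{R}^3$ and $v\in\mathbf{S}^2$. That is: if $(f,\alpha_1,\rho_1)$ and $(\tilde f,\tilde\alpha_1,\tilde\rho_1)$ are two triples satisfying these assumptions (with the same $\Sigma$ and $\varepsilon$), with associated data $M_{0,x},N_{\infty,x}$ and $\tilde M_{0,x},\tilde N_{\infty,x}$, and if $M_{0,x}(y)=\tilde M_{0,x}(y)$ and $N_{\infty,x}(y)=\tilde N_{\infty,x}(y)$ for all $x\in\Sigma$ and all $y\in\mathbb{R}^3\setminus\{x\}$, then $X_3[\varepsilon\alpha_1](y,v)=X_3[\varepsilon\tilde\alpha_1](y,v)$ for all $y\in\mathbb{R}^3$, $v\in\mathbf{S}^2$.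
   Context: Setting: $\Sigma=\partial D$ for a bounded open set $D\subset\mathbb{R}^3$ (the detector surface); $f:\mathbb{R}^3\to[0,\infty)$ is a continuous function with compact support $\operatorname{supp}f\subset D$ ($\Sigma$ encloses $\operatorname{supp}f$); $\alpha_1\in C^2_{\mathrm c}(\mathbb{R}^3)$ and $\rho_1\in C^1_{\mathrm c}(\mathbb{R}^3)$ are real-valued; $\varepsilon>0$ is fixed. With $\mathscr E_t(x,y)=\{z\in\mathbb{R}^3\mid|z-x|+|z-y|\le t\}$, the kernel is, for $t\ge|y-x|$, $x\ne y$, $$\begin{aligned}K(t,x,y;\varepsilon)&=\frac{(t-|y-x|)^2}{8\pi|y-x|}\,(1-\varepsilon\alpha_1(y))+\int_{\mathscr E_t(x,y)}\frac{1}{16\pi^2|z-x||z-y|}\,\varepsilon\alpha_1(z)\,\mathrm{d}z\\&\quad+\int_{\mathscr E_t(x,y)}\frac{t-|z-x|-|z-y|}{16\pi^2|z-x||z-y|}\,\varepsilon\nabla\rho_1(z)\cdot\frac{z-y}{|z-y|}\,\mathrm{d}z\\&\quad+\int_{\mathscr E_t(x,y)}\frac{(t-|z-x|-|z-y|)^2}{32\pi^2|z-x||z-y|^2}\,\varepsilon\nabla\rho_1(z)\cdot\frac{z-y}{|z-y|}\,\mathrm{d}z,\end{aligned}$$ and $K(t,x,y;\varepsilon)=0$ for $t<|y-x|$. The measurements are $M_{r,\theta}(t,x)=\int_{B_t(x)\cap E_{r,\theta}}K(t,x,y;\varepsilon)f(y)\,\mathrm{d}s(y)=\mathcal R_3[K(t,x,\cdot\,;\varepsilon)f](r,\theta)$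 for $x\in\Sigma$, $t>0$, $r\ge0$, $\theta\in\mathbf{S}^2$, where $E_{r,\theta}=\{y\in\mathbb{R}^3\mid y\cdot\theta=r\}$ and $\mathcal R_3$ is the three-dimensional Radon transform (integration over planes). Hence $\mathcal R_3^{-1}[M_{r,\theta}(t,x)](y)=K(t,x,y;\varepsilon)f(y)$. The data are, for $x\in\Sigma$ and $y\in\mathbb{R}^3\setminus\{x\}$, $$M_{0,x}(y)=\lim_{t\downarrow|y-x|}\partial_t\mathcal R_3^{-1}[M_{r,\theta}(t,x)](y),\qquad M_{\infty,x}(y)=\lim_{t\to\infty}\partial_{tt}\mathcal R_3^{-1}[M_{r,\theta}(t,x)](y),$$ $$N_{\infty,x}(y)=\lim_{t\to\infty}\Big(M_{\infty,x}(y)\,t-\partial_t\mathcal R_3^{-1}[M_{r,\theta}(t,x)](y)\Big).$$ The X-ray transform is $X_3[g](y,v)=\int_{-\infty}^{\infty}g(y+\lambda v)\,\mathrm{d}\lambda$ for $y\in\mathbb{R}^3$, $v\in\mathbf{S}^2$. *)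

theory Defs
  imports "HOL-Analysis.Analysis"
begin

definition supp :: "(real^3 \<Rightarrow> real) \<Rightarrow> (real^3) set" where
  "supp g = closure {z. g z \<noteq> 0}"

definition gradient :: "(real^3 \<Rightarrow> real) \<Rightarrow> real^3 \<Rightarrow> real^3" where
  "gradient g z = (THE d. GDERIV g z :> d)"

fun C_k :: "nat \<Rightarrow> (real^3 \<Rightarrow> real) \<Rightarrow> bool" where
  "C_k 0 g \<longleftrightarrow> continuous_on UNIV g"
| "C_k (Suc k) g \<longleftrightarrow>
     (\<forall>z. g differentiable (at z)) \<and> (\<forall>i. C_k k (\<lambda>z. gradient g z $ i))"

definition C_k_c :: "nat \<Rightarrow> (real^3 \<Rightarrow> real) \<Rightarrow> bool" where
  "C_k_c k g \<longleftrightarrow> C_k k g \<and> compact (supp g)"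

definition plane :: "real \<Rightarrow> real^3 \<Rightarrow> (real^3) set" where
  "plane r \<theta> = {y. y \<bullet> \<theta> = r}"

definition plane_basis :: "real^3 \<Rightarrow> (real^3) \<times> (real^3)" where
  "plane_basis \<theta> =
     (SOME (u, v). norm u = 1 \<and> norm v = 1 \<and> u \<bullet> v = 0 \<and> u \<bullet> \<theta> = 0 \<and> v \<bullet> \<theta> = 0)"

text \<open>For a unit vector \<open>\<theta>\<close> this is the surface measure \<open>ds\<close> of the plane \<open>y \<bullet> \<theta> = r\<close>: the image of
  planar Lebesgue measure under an isometric parametrization. By rotation invariance of Lebesgue
  measure it does not depend on the orthonormal basis that was picked.\<close>

definition plane_measure :: "real \<Rightarrow> real^3 \<Rightarrow> (real^3) measure" where
  "plane_measure r \<theta> =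
     distr (lborel :: (real \<times> real) measure) borel
       (\<lambda>(a, b). r *\<^sub>R \<theta> + a *\<^sub>R fst (plane_basis \<theta>) + b *\<^sub>R snd (plane_basis \<theta>))"

definition radon :: "(real^3 \<Rightarrow> real) \<Rightarrow> real \<Rightarrow> real^3 \<Rightarrow> real" where
  "radon g r \<theta> = (LINT y:plane r \<theta>|plane_measure r \<theta>. g y)"

text \<open>The three-dimensional Radon transform is injective on continuous functions of compact
  support; \<open>radon_inv\<close> is its inverse on the range of that space. This is the relevant space
  because \<open>K(t, x, \<cdot>) f\<close> is continuous with compact support whenever \<open>x \<notin> supp f\<close>, but in general
  not smooth, so that differentiation-based inversion formulas do not apply pointwise.\<close>

definition radon_inv :: "(real \<Rightarrow> real^3 \<Rightarrow> real) \<Rightarrow> real^3 \<Rightarrow> real" where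
  "radon_inv m =
     (THE g. C_k_c 0 g \<and> (\<forall>r\<ge>0. \<forall>\<theta>\<in>sphere 0 1. radon g r \<theta> = m r \<theta>))"

definition xray :: "(real^3 \<Rightarrow> real) \<Rightarrow> real^3 \<Rightarrow> real^3 \<Rightarrow> real" where
  "xray g y v = (LINT s|lborel. g (y + s *\<^sub>R v))"

definition ellipsoid :: "real \<Rightarrow> real^3 \<Rightarrow> real^3 \<Rightarrow> (real^3) set" where
  "ellipsoid t x y = {z. norm (z - x) + norm (z - y) \<le> t}"

text \<open>The kernel is only meaningful for \<open>x \<noteq> y\<close>. Below it occurs only multiplied by \<open>f y\<close>, with
  \<open>x\<close> outside the support of \<open>f\<close>, so its value at \<open>y = x\<close> plays no role.\<close>

definition kernel ::
  "real \<Rightarrow> (real^3 \<Rightarrow> real) \<Rightarrow> (real^3 \<Rightarrow> real) \<Rightarrow> real \<Rightarrow> real^3 \<Rightarrow> real^3 \<Rightarrow> real" where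
  "kernel \<epsilon> \<alpha> \<rho> t x y =
     (if t < norm (y - x) then 0 else
        (t - norm (y - x))\<^sup>2 / (8 * pi * norm (y - x)) * (1 - \<epsilon> * \<alpha> y)
      + (LINT z:ellipsoid t x y|lborel.
           1 / (16 * pi\<^sup>2 * norm (z - x) * norm (z - y)) * (\<epsilon> * \<alpha> z))
      + (LINT z:ellipsoid t x y|lborel.
           (t - norm (z - x) - norm (z - y)) / (16 * pi\<^sup>2 * norm (z - x) * norm (z - y))
           * ((\<epsilon> *\<^sub>R gradient \<rho> z) \<bullet> ((z - y) /\<^sub>R norm (z - y))))
      + (LINT z:ellipsoid t x y|lborel.
           (t - norm (z - x) - norm (z - y))\<^sup>2 / (32 * pi\<^sup>2 * norm (z - x) * (norm (z - y))\<^sup>2)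
           * ((\<epsilon> *\<^sub>R gradient \<rho> z) \<bullet> ((z - y) /\<^sub>R norm (z - y)))))"

definition measurement ::
  "real \<Rightarrow> (real^3 \<Rightarrow> real) \<Rightarrow> (real^3 \<Rightarrow> real) \<Rightarrow> (real^3 \<Rightarrow> real)
   \<Rightarrow> real \<Rightarrow> real^3 \<Rightarrow> real \<Rightarrow> real^3 \<Rightarrow> real" where
  "measurement \<epsilon> f \<alpha> \<rho> t x r \<theta> =
     (LINT y:ball x t \<inter> plane r \<theta>|plane_measure r \<theta>. kernel \<epsilon> \<alpha> \<rho> t x y * f y)"

definition data_M0 ::
  "real \<Rightarrow> (real^3 \<Rightarrow> real) \<Rightarrow> (real^3 \<Rightarrow> real) \<Rightarrow> (real^3 \<Rightarrow> real)
   \<Rightarrow> real^3 \<Rightarrow> real^3 \<Rightarrow> real" where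
  "data_M0 \<epsilon> f \<alpha> \<rho> x y =
     Lim (at_right (norm (y - x))) (deriv (\<lambda>t. radon_inv (measurement \<epsilon> f \<alpha> \<rho> t x) y))"

definition data_Minf ::
  "real \<Rightarrow> (real^3 \<Rightarrow> real) \<Rightarrow> (real^3 \<Rightarrow> real) \<Rightarrow> (real^3 \<Rightarrow> real)
   \<Rightarrow> real^3 \<Rightarrow> real^3 \<Rightarrow> real" where
  "data_Minf \<epsilon> f \<alpha> \<rho> x y =
     Lim at_top (deriv (deriv (\<lambda>t. radon_inv (measurement \<epsilon> f \<alpha> \<rho> t x) y)))"

definition data_Ninf ::
  "real \<Rightarrow> (real^3 \<Rightarrow> real) \<Rightarrow> (real^3 \<Rightarrow> real) \<Rightarrow> (real^3 \<Rightarrow> real)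
   \<Rightarrow> real^3 \<Rightarrow> real^3 \<Rightarrow> real" where
  "data_Ninf \<epsilon> f \<alpha> \<rho> x y =
     Lim at_top (\<lambda>t. data_Minf \<epsilon> f \<alpha> \<rho> x y * t
                     - deriv (\<lambda>t. radon_inv (measurement \<epsilon> f \<alpha> \<rho> t x) y) t)"

definition admissible ::
  "(real^3) set \<Rightarrow> (real^3 \<Rightarrow> real) \<Rightarrow> (real^3 \<Rightarrow> real) \<Rightarrow> (real^3 \<Rightarrow> real) \<Rightarrow> bool" where
  "admissible D f \<alpha> \<rho> \<longleftrightarrow>
     C_k_c 0 f \<and> (\<forall>y. 0 \<le> f y) \<and> supp f \<subseteq> D
     \<and> C_k_c 2 \<alpha> \<and> C_k_c 1 \<rho>
     \<and> supp \<alpha> \<union> supp \<rho> \<subset> interior (supp f)"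

end

theory Submission
  imports Defs
begin

text \<open>
  A detector position \<open>x\<close> on the frontier of \<open>D\<close> lies outside the support of \<open>f\<close>. There the map
  \<open>y \<mapsto> K(t, x, y) f(y)\<close> is continuous with compact support, and the Radon transform is injective
  on such functions; hence the reconstruction from the measurements is \<open>K(t, x, y) f(y)\<close>
  (\<open>radon_inv_measurement\<close>). Injectivity (\<open>radon_injective\<close>) is proved by integrating over
  parallel planes: a function with vanishing Radon transform is orthogonal to all exponentials
  \<open>exp (y \<bullet> \<xi>)\<close>, whose span is an algebra that is dense by the Stone--Weierstrass theorem.

  It suffices to read off the data at points \<open>y\<close> outside the supports of \<open>\<alpha>\<close> and \<open>\<rho>\<close>. For large
  \<open>t\<close> the kernel is a quadratic polynomial in \<open>t\<close>, and the combination of its coefficients that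
  defines \<open>N\<close> is, up to the flux of the gradient of \<open>\<rho>\<close> against \<open>(z - y) / norm (z - y) ^ 3\<close>, just
  \<open>f(y) / (4 \<pi>)\<close>. This flux vanishes: \<open>\<lambda> \<mapsto> \<integral> \<rho>(y + \<lambda> u) / norm u ^ 3 du\<close> is constant because
  \<open>du / norm u ^ 3\<close> is invariant under dilations, and the flux is its derivative at \<open>1\<close>. So
  \<open>N(y) = f(y) / (4 \<pi>)\<close> (\<open>data_Ninf_eq\<close>).

  As \<open>t\<close> decreases to \<open>norm (y - x)\<close>, the ellipsoid collapses to the segment from \<open>x\<close> to \<open>y\<close>.
  Writing the ellipsoid as an affine image of the unit ball, one can differentiate the integral
  over it and pass to the limit; the weight \<open>1 / (norm (z - x) * norm (z - y))\<close> exactly cancels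
  the area of the cross sections of the ball. Hence \<open>M\<^sub>0(y)\<close> is \<open>f(y)\<close> times
  \<open>\<epsilon> / (16 \<pi>)\<close> times the integral of \<open>\<alpha>\<close> over the segment, parametrized over \<open>[-1, 1]\<close>
  (\<open>data_M0_eq\<close>).

  Now let a line meet one of the four supports of \<open>\<alpha>\<close>, \<open>\<rho>\<close>, \<open>\<alpha>'\<close>, \<open>\<rho>'\<close>. The last such point of the
  line is interior to the support of one of the sources, say of \<open>f\<close>, so just behind it there is
  a point \<open>y\<close> outside the four supports that is a limit of points with \<open>f \<noteq> 0\<close>. At those points
  \<open>f = f'\<close> by the second datum, so the first datum yields equal segment integrals of \<open>\<alpha>\<close> and
  \<open>\<alpha>'\<close>, also at \<open>y\<close> by continuity. Taking for \<open>x\<close> a frontier point before the first point of the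
  line in the supports, the segment integrals are the integrals over the whole line.
\<close>

section \<open>Supports, gradients and integrability\<close>

lemma C_k_c_0_iff: "C_k_c 0 g \<longleftrightarrow> continuous_on UNIV g \<and> compact (supp g)"
  by (simp add: C_k_c_def)

lemma not_in_supp: "z \<notin> supp g \<Longrightarrow> g z = 0"
  using closure_subset by (force simp: supp_def)

lemma closed_supp: "closed (supp g)"
  by (simp add: supp_def)

lemma supp_subset: "(\<And>z. g z \<noteq> 0 \<Longrightarrow> z \<in> S) \<Longrightarrow> closed S \<Longrightarrow> supp g \<subseteq> S"
  unfolding supp_def by (rule closure_minimal) auto

lemma compact_suppI: "(\<And>z. g z \<noteq> 0 \<Longrightarrow> z \<in> S) \<Longrightarrow> compact S \<Longrightarrow> compact (supp g)"
  using supp_subset[of g S] closed_supp[of g] compact_Int_closed[of S "supp g"]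
  by (simp add: compact_imp_closed Int_absorb1)

lemma GDERIV_unique: "GDERIV g z :> d \<Longrightarrow> GDERIV g z :> e \<Longrightarrow> d = e"
  unfolding gderiv_def by (metis has_derivative_unique inner_commute vector_eq_ldot)

lemma gradient_eqI: "GDERIV g z :> d \<Longrightarrow> gradient g z = d"
  unfolding gradient_def by (rule the_equality) (auto intro: GDERIV_unique)

lemma GDERIV_gradient:
  assumes "g differentiable (at z)"
  shows "GDERIV g z :> gradient g z"
proof -
  obtain g' where g': "(g has_derivative g') (at z)" using assms differentiable_def by blast
  hence "linear g'" by (rule has_derivative_linear)
  hence "g' = (\<lambda>h. h \<bullet> adjoint g' 1)" by (simp add: adjoint_works fun_eq_iff)
  hence "GDERIV g z :> adjoint g' 1" using g' by (simp add: gderiv_def)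
  thus ?thesis using gradient_eqI by metis
qed

lemma gradient_not_in_supp: 
  assumes "z \<notin> supp g" shows "gradient g z = 0"
proof (rule gradient_eqI)
  have "((\<lambda>_. 0) has_derivative (\<lambda>h. 0)) (at z)" by simp
  hence "(g has_derivative (\<lambda>h. 0)) (at z)"
    by (rule has_derivative_transform_within_open[of _ _ _ _ "- supp g"])
       (use assms closed_supp in \<open>auto simp: not_in_supp\<close>)
  thus "GDERIV g z :> 0" by (simp add: gderiv_def)
qed

lemma C_1_D:
  assumes "C_k (Suc 0) g"
  shows "GDERIV g z :> gradient g z" "continuous_on UNIV (gradient g)" "continuous_on UNIV g"
proof -
  have d: "g differentiable (at z)" for z using assms by simp
  show "GDERIV g z :> gradient g z" by (rule GDERIV_gradient[OF d])
  have "\<And>i. continuous_on UNIV (\<lambda>z. gradient g z $ i)" using assms by simp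
  thus "continuous_on UNIV (gradient g)"
    using continuous_on_vec_lambda[of UNIV "\<lambda>i z. gradient g z $ i"] by simp
  show "continuous_on UNIV g"
    using d by (simp add: differentiable_imp_continuous_within continuous_at_imp_continuous_on)
qed

lemma C_k_Suc_imp: "C_k (Suc k) g \<Longrightarrow> C_k k g"
proof (induction k arbitrary: g)
  case 0
  thus ?case using C_1_D(3) by simp
next
  case (Suc k)
  thus ?case by (metis C_k.simps(2))
qed

lemma C_k_c_1_imp_0: "C_k_c (Suc 0) g \<Longrightarrow> C_k_c 0 g"
  using C_k_Suc_imp by (auto simp: C_k_c_def simp del: C_k.simps)

lemma continuous_supp_bounded:
  fixes g :: "'a::euclidean_space \<Rightarrow> 'b::real_normed_vector"
  assumes "continuous_on UNIV g" "compact S" "\<And>z. z \<notin> S \<Longrightarrow> g z = 0"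
  obtains M where "0 \<le> M" "\<And>z. norm (g z) \<le> M"
proof -
  have "compact (g ` S)"
    using assms by (meson compact_continuous_image continuous_on_subset subset_UNIV)
  then obtain M where "\<forall>w\<in>g ` S. norm w \<le> M"
    using compact_imp_bounded bounded_iff by metis
  hence "norm (g z) \<le> max M 0" for z using assms(3)[of z] by (cases "z \<in> S") fastforce+
  thus ?thesis using that[of "max M 0"] by auto
qed

lemma C_k_c_1_Lipschitz:
  assumes "C_k_c 1 g"
  obtains M where "0 \<le> M" "\<And>z. norm (gradient g z) \<le> M" "\<And>z w. \<bar>g z - g w\<bar> \<le> M * norm (z - w)"
proof -
  have rc: "C_k (Suc 0) g" and comp: "compact (supp g)" using assms by (auto simp: C_k_c_def)
  obtain M where M: "0 \<le> M" "\<And>z. norm (gradient g z) \<le> M"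
    using continuous_supp_bounded[OF C_1_D(2)[OF rc] comp] gradient_not_in_supp by metis
  have "norm (g z - g w) \<le> M * norm (z - w)" for z w
  proof (rule differentiable_bound[of UNIV])
    show "(g has_derivative (\<lambda>h. h \<bullet> gradient g z)) (at z within UNIV)" for z
      using C_1_D(1)[OF rc] by (simp add: gderiv_def)
    show "onorm (\<lambda>h. h \<bullet> gradient g z) \<le> M" for z
    proof (rule onorm_le)
      fix h
      have "\<bar>h \<bullet> gradient g z\<bar> \<le> norm h * norm (gradient g z)" by (rule Cauchy_Schwarz_ineq2)
      also have "\<dots> \<le> norm h * M" by (intro mult_left_mono M) simp
      finally show "norm (h \<bullet> gradient g z) \<le> M * norm h" by (simp add: mult.commute)
    qed
  qed auto
  thus ?thesis using that M by simp
qed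

lemma continuous_scaleR_off_supp:
  fixes g :: "real^3 \<Rightarrow> 'b::real_normed_vector"
  assumes g: "continuous_on UNIV g" and S: "closed S" and out: "\<And>z. z \<notin> S \<Longrightarrow> g z = 0"
    and h: "\<And>z. z \<in> S \<Longrightarrow> isCont h z"
  shows "continuous_on UNIV (\<lambda>z. h z *\<^sub>R g z)"
proof (rule continuous_at_imp_continuous_on, rule ballI)
  fix z
  show "isCont (\<lambda>z. h z *\<^sub>R g z) z"
  proof (cases "z \<in> S")
    case True
    thus ?thesis using g h by (intro continuous_intros) (auto simp: continuous_on_eq_continuous_at)
  next
    case False
    have "eventually (\<lambda>z. z \<in> - S) (nhds z)"
      using False S by (intro eventually_nhds_in_open) auto
    hence "eventually (\<lambda>z. h z *\<^sub>R g z = 0) (nhds z)"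
      by eventually_elim (simp add: out)
    thus ?thesis using isCont_cong[of "\<lambda>z. h z *\<^sub>R g z" "\<lambda>_. 0"] by force
  qed
qed

text \<open>Dividing by the distance to a point outside the support keeps a function in \<open>C\<^sup>1\<close>.\<close>

lemma C_k_c_1_over_norm:
  assumes g: "C_k_c 1 g" and x: "x \<notin> supp g"
  shows "C_k_c 1 (\<lambda>z. g z / norm (z - x))"
proof -
  let ?h = "\<lambda>z. g z / norm (z - x)"
  have rc: "C_k (Suc 0) g" and comp: "compact (supp g)" using g by (auto simp: C_k_c_def)
  note gd = C_1_D(1)[OF rc] and gc = C_1_D(2)[OF rc] and cont = C_1_D(3)[OF rc]
  define G where "G = (\<lambda>z. (1 / norm (z - x)) *\<^sub>R gradient g z - (1 / norm (z - x) ^ 3) *\<^sub>R (g z *\<^sub>R (z - x)))"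
  have G: "GDERIV ?h z :> G z" for z
  proof (cases "z \<in> supp g")
    case True
    hence zx: "z \<noteq> x" using x by auto
    have "((\<lambda>z. z - x) has_derivative (\<lambda>h. h)) (at z)" by (auto intro!: derivative_eq_intros)
    moreover have "(norm has_derivative (\<lambda>h. h \<bullet> sgn (z - x))) (at (z - x))"
      using GDERIV_norm[of "z - x"] zx by (simp add: gderiv_def)
    ultimately have n: "((\<lambda>z. norm (z - x)) has_derivative (\<lambda>h. h \<bullet> sgn (z - x))) (at z)"
      by (rule has_derivative_compose)
    have "(?h has_derivative (\<lambda>h. h \<bullet> G z)) (at z)"
      using zx
      by (auto intro!: derivative_eq_intros n gd[of z, unfolded gderiv_def]
           simp: G_def inner_diff_right sgn_div_norm divide_simps power3_eq_cube power2_eq_square)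
    thus ?thesis by (simp add: gderiv_def)
  next
    case False
    have "(?h has_derivative (\<lambda>h. 0)) (at z)"
      by (rule has_derivative_transform_within_open[of "\<lambda>_. 0" _ _ _ "- supp g"])
         (use False closed_supp in \<open>auto simp: not_in_supp\<close>)
    thus ?thesis using False by (simp add: gderiv_def G_def not_in_supp gradient_not_in_supp)
  qed
  have "continuous_on UNIV (\<lambda>z. (1 / norm (z - x)) *\<^sub>R gradient g z)"
    by (rule continuous_scaleR_off_supp[OF gc closed_supp[of g]])
       (use x in \<open>auto simp: gradient_not_in_supp intro!: continuous_intros\<close>)
  moreover have "continuous_on UNIV (\<lambda>z. (1 / norm (z - x) ^ 3) *\<^sub>R (g z *\<^sub>R (z - x)))"
    by (rule continuous_scaleR_off_supp[OF _ closed_supp[of g]])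
       (use x in \<open>auto simp: not_in_supp intro!: continuous_intros cont\<close>)
  ultimately have Gc: "continuous_on UNIV G" unfolding G_def by (rule continuous_on_diff)
  have "gradient ?h = G" using G gradient_eqI by blast
  hence "C_k (Suc 0) ?h"
    using G Gc by (auto simp: gderiv_def differentiable_def intro!: continuous_on_component)
  moreover have "compact (supp ?h)"
    by (rule compact_suppI[OF _ comp]) (auto, metis not_in_supp)
  ultimately show ?thesis by (simp add: C_k_c_def)
qed

lemma integrable_bounded_support:
  fixes g :: "'a::euclidean_space \<Rightarrow> real"
  assumes [measurable]: "g \<in> borel_measurable borel"
    and bnd: "\<And>z. \<bar>g z\<bar> \<le> M" and out: "\<And>z. z \<notin> S \<Longrightarrow> g z = 0" and S: "bounded S"
  shows "integrable lborel g"
proof -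
  obtain R where "\<And>z. z \<in> S \<Longrightarrow> norm z \<le> R" using S bounded_iff by metis
  hence R: "S \<subseteq> cball 0 R" by auto
  have "integrable lborel (\<lambda>z. M * indicator (cball 0 R) z :: real)"
    by (intro integrable_mult_right integrable_real_indicator)
      (auto simp: emeasure_lborel_cball_finite[unfolded infinity_ennreal_def])
  thus ?thesis
  proof (rule Bochner_Integration.integrable_bound)
    have "\<bar>g z\<bar> \<le> \<bar>M * indicator (cball 0 R) z\<bar>" for z
      using bnd[of z] out[of z] subsetD[OF R, of z]
      by (cases "z \<in> cball 0 R") (auto simp: indicator_def)
    thus "AE z in lborel. norm (g z) \<le> norm (M * indicator (cball 0 R) z)" by simp
  qed simp
qed

lemma integrable_continuous_compact:
  fixes g :: "'a::euclidean_space \<Rightarrow> real"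
  assumes "continuous_on UNIV g" "compact S" "\<And>z. z \<notin> S \<Longrightarrow> g z = 0"
  shows "integrable lborel g"
proof -
  obtain M where "\<And>z. norm (g z) \<le> M" using continuous_supp_bounded[OF assms] by metis
  thus ?thesis
    using assms by (intro integrable_bounded_support[where M = M and S = S])
      (auto intro: borel_measurable_continuous_onI compact_imp_bounded)
qed

section \<open>Orthonormal frames and affine substitutions\<close>

text \<open>An orthonormal frame of three vectors.\<close>

definition orthonormal3 :: "real^3 \<Rightarrow> real^3 \<Rightarrow> real^3 \<Rightarrow> bool" where
  "orthonormal3 a b c \<longleftrightarrow>
     norm a = 1 \<and> norm b = 1 \<and> norm c = 1 \<and> a \<bullet> b = 0 \<and> a \<bullet> c = 0 \<and> b \<bullet> c = 0"

text \<open>The linear map that sends coordinates with respect to the frame to the vector. The nesting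
\<open>real \<times> (real \<times> real)\<close> separates the first direction from the plane spanned by the other two.\<close>

definition frame_map :: "real^3 \<Rightarrow> real^3 \<Rightarrow> real^3 \<Rightarrow> real \<times> real \<times> real \<Rightarrow> real^3" where
  "frame_map a b c = (\<lambda>(r, p, q). r *\<^sub>R a + p *\<^sub>R b + q *\<^sub>R c)"

lemma plane_basis_orthonormal:
  assumes "norm \<theta> = 1"
  shows "orthonormal3 \<theta> (fst (plane_basis \<theta>)) (snd (plane_basis \<theta>))"
proof -
  let ?P = "\<lambda>(u::real^3, v). norm u = 1 \<and> norm v = 1 \<and> u \<bullet> v = 0 \<and> u \<bullet> \<theta> = 0 \<and> v \<bullet> \<theta> = 0"
  obtain w :: "real^3" where w: "w \<noteq> 0" "orthogonal \<theta> w"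
    using orthogonal_to_vector_exists[of \<theta>] by auto
  define u where "u = w /\<^sub>R norm w"
  have u: "norm u = 1" "u \<bullet> \<theta> = 0"
    using w by (auto simp: u_def orthogonal_def inner_commute)
  define v where "v = cross3 \<theta> u"
  have "(norm v)\<^sup>2 = 1"
    using norm_cross[of \<theta> u] assms u by (simp add: v_def inner_commute)
  hence "norm v = 1" by (metis norm_ge_zero one_power2 power2_eq_imp_eq zero_le_one)
  moreover have "u \<bullet> v = 0" "v \<bullet> \<theta> = 0"
    by (simp_all add: v_def dot_cross_self)
  ultimately have "?P (u, v)" using u by simp
  hence "?P (plane_basis \<theta>)"
    unfolding plane_basis_def by (rule someI)
  thus ?thesis
    using assms by (auto simp: orthonormal3_def inner_commute split: prod.splits)
qed

lemma measurable_coordinates: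
  "(\<lambda>(r, p, q). vector [r, p, q] :: real^3) \<in> borel_measurable lborel"
proof -
  have "(\<lambda>(r, p, q). vector [r, p, q] :: real^3)
      = (\<lambda>x. fst x *\<^sub>R axis 1 1 + fst (snd x) *\<^sub>R axis 2 1 + snd (snd x) *\<^sub>R axis 3 1)"
    by (auto simp: fun_eq_iff vec_eq_iff forall_3 axis_def split: prod.splits)
  thus ?thesis
    by (auto intro!: borel_measurable_continuous_onI continuous_intros)
qed

lemma Basis_triple: "(Basis :: (real \<times> real \<times> real) set) = {(1, 0, 0), (0, 1, 0), (0, 0, 1)}"
  by (auto simp: Basis_prod_def zero_prod_def)

lemma distr_coordinates_lborel:
  "distr lborel borel (\<lambda>(r, p, q). vector [r, p, q] :: real^3) = lborel"
proof (rule lborel_eqI[symmetric])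
  let ?J = "\<lambda>(r, p, q). vector [r, p, q] :: real^3"
  have meas: "?J \<in> borel_measurable lborel"
    by (rule measurable_coordinates)
  show "sets (distr lborel borel ?J) = sets borel" by simp
  fix l u :: "real^3" assume lu: "\<And>b. b \<in> Basis \<Longrightarrow> l \<bullet> b \<le> u \<bullet> b"
  have le: "l $ i \<le> u $ i" for i
    using lu[of "axis i 1"] by (auto simp: axis_in_Basis_iff inner_axis)
  have "x \<in> box (l$1, l$2, l$3) (u$1, u$2, u$3) \<longleftrightarrow>
      l$1 < fst x \<and> fst x < u$1 \<and> l$2 < fst (snd x) \<and> fst (snd x) < u$2
      \<and> l$3 < snd (snd x) \<and> snd (snd x) < u$3" for x
    by (cases x) (auto simp: box_def Basis_prod_def)
  hence "?J -` box l u = box (l$1, l$2, l$3) (u$1, u$2, u$3)"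
    by (auto simp: mem_box_cart forall_3)
  hence "emeasure (distr lborel borel ?J) (box l u) = emeasure lborel (box (l$1, l$2, l$3) (u$1, u$2, u$3))"
    using meas by (subst emeasure_distr) auto
  also have "\<dots> = ennreal (prod ((\<bullet>) ((u$1, u$2, u$3) - (l$1, l$2, l$3))) Basis)"
    using le by (intro emeasure_lborel_box) (auto simp: Basis_prod_def)
  also have "prod ((\<bullet>) ((u$1, u$2, u$3) - (l$1, l$2, l$3))) Basis = (u$1 - l$1) * ((u$2 - l$2) * (u$3 - l$3))"
    unfolding Basis_triple by (simp add: mult.assoc)
  also have "\<dots> = prod ((\<bullet>) (u - l)) Basis"
  proof -
    have B: "(Basis :: (real^3) set) = {axis 1 1, axis 2 1, axis 3 1}"
      unfolding Basis_vec_def by (auto simp: UNIV_3)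
    have "axis 1 1 \<noteq> (axis 2 1 :: real^3)" "axis 1 1 \<noteq> (axis 3 1 :: real^3)" "axis 2 1 \<noteq> (axis 3 1 :: real^3)"
      by (auto simp: axis_eq_axis)
    thus ?thesis unfolding B by (simp add: inner_axis)
  qed
  finally show "emeasure (distr lborel borel ?J) (box l u) = prod ((\<bullet>) (u - l)) Basis" .
qed

lemma distr_orthogonal_lborel:
  fixes g :: "real^3 \<Rightarrow> real^3"
  assumes g: "orthogonal_transformation g"
  shows "distr lborel borel g = lborel"
proof (rule lborel_eqI[symmetric])
  have lin: "linear g" and bij: "bij g"
    using g orthogonal_transformation_linear orthogonal_transformation_bij by auto
  have cont: "continuous_on UNIV g" using lin linear_continuous_on linear_conv_bounded_linear by blast
  have meas: "g \<in> borel_measurable lborel" 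
    using borel_measurable_continuous_onI[OF cont] by simp
  show "sets (distr lborel borel g) = sets borel" by simp
  fix l u :: "real^3" assume lu: "\<And>b. b \<in> Basis \<Longrightarrow> l \<bullet> b \<le> u \<bullet> b"
  have inv: "orthogonal_transformation (inv g)"
    using g orthogonal_transformation_inv by blast
  have vim: "g -` box l u = inv g ` box l u"
    by (rule bij_vimage_eq_inv_image[OF bij])
  have lm: "inv g ` box l u \<in> lmeasurable"
    by (rule measurable_orthogonal_image[OF inv]) simp
  have br: "g -` box l u \<in> sets borel" using meas by (auto simp: measurable_def)
  have "emeasure (distr lborel borel g) (box l u) = emeasure lborel (g -` box l u)"
    using meas by (subst emeasure_distr) auto
  also have "\<dots> = emeasure lebesgue (inv g ` box l u)"
    using br by (simp add: vim)
  also have "\<dots> = measure lebesgue (inv g ` box l u)"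
    using lm by (simp add: emeasure_eq_measure2)
  also have "\<dots> = measure lebesgue (box l u)"
    using measure_orthogonal_image[OF inv] by simp
  also have "\<dots> = emeasure lborel (box l u)"
    using emeasure_lborel_box_finite[of l u] by (subst emeasure_eq_ennreal_measure) auto
  also have "\<dots> = prod ((\<bullet>) (u - l)) Basis"
    by (rule emeasure_lborel_box) (use lu in auto)
  finally show "emeasure (distr lborel borel g) (box l u) = prod ((\<bullet>) (u - l)) Basis" .
qed

lemma frame_map_measurable [measurable]: "frame_map a b c \<in> borel_measurable borel"
  unfolding frame_map_def split_beta
  by (intro borel_measurable_continuous_onI continuous_intros)

lemma norm_frame_map:
  assumes "orthonormal3 a b c"
  shows "(norm (frame_map a b c (r, p, q)))\<^sup>2 = r\<^sup>2 + p\<^sup>2 + q\<^sup>2"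
  using assms unfolding orthonormal3_def frame_map_def power2_norm_eq_inner
  by (simp add: inner_add_left inner_add_right inner_commute power2_eq_square norm_eq_1)

lemma norm_frame_map_le:
  assumes "orthonormal3 a b c"
  shows "norm (frame_map a b c (r, p, q)) \<le> \<bar>r\<bar> + \<bar>p\<bar> + \<bar>q\<bar>"
proof -
  have "norm (frame_map a b c (r, p, q)) \<le> norm (r *\<^sub>R a) + norm (p *\<^sub>R b) + norm (q *\<^sub>R c)"
    unfolding frame_map_def prod.case by (intro norm_triangle_le add_mono norm_triangle_ineq order_refl)
  thus ?thesis using assms by (simp add: orthonormal3_def)
qed

lemma frame_map_diff:
  "frame_map a b c (r, p, q) - frame_map a b c (r', p', q') = frame_map a b c (r - r', p - p', q - q')"
  by (simp add: frame_map_def algebra_simps)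

lemma distr_frame_map_lborel:
  assumes on: "orthonormal3 a b c"
  shows "distr lborel borel (frame_map a b c) = lborel"
proof -
  define g where "g = (\<lambda>w::real^3. w$1 *\<^sub>R a + w$2 *\<^sub>R b + w$3 *\<^sub>R c)"
  have gf: "g w = frame_map a b c (w$1, w$2, w$3)" for w by (simp add: g_def frame_map_def)
  have "linear g"
    by (rule linearI) (auto simp: g_def algebra_simps)
  moreover have "norm (g w) = norm w" for w
  proof -
    have "(norm (g w))\<^sup>2 = (norm w)\<^sup>2"
      unfolding gf norm_frame_map[OF on] unfolding power2_norm_eq_inner by
        (simp add: inner_vec_def sum_3 power2_eq_square)
    thus ?thesis by (simp add: power2_eq_iff_nonneg)
  qed
  ultimately have orth: "orthogonal_transformation g"
    by (simp add: orthogonal_transformation)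
  have g_meas [measurable]: "g \<in> borel_measurable borel"
    unfolding g_def by (intro borel_measurable_continuous_onI continuous_intros)
  let ?J = "\<lambda>(r, p, q). vector [r, p, q] :: real^3"
  have J_meas: "?J \<in> borel_measurable borel"
    using measurable_coordinates by simp
  have "frame_map a b c = g \<circ> ?J" by (auto simp: fun_eq_iff gf)
  hence "distr lborel borel (frame_map a b c) = distr (distr lborel borel ?J) borel g"
    using J_meas by (subst distr_distr) auto
  thus ?thesis
    by (simp add: distr_coordinates_lborel distr_orthogonal_lborel[OF orth])
qed

text \<open>Fubini for integration over the planes orthogonal to the first vector of a frame.\<close>

lemma integral_frame:
  fixes g :: "real^3 \<Rightarrow> real"
  assumes on: "orthonormal3 a b c" and g: "integrable lborel g"
  shows "integral\<^sup>L lborel g = (\<integral>r. (\<integral>w. g (frame_map a b c (r, w)) \<partial>lborel) \<partial>lborel)"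
proof -
  have psf: "pair_sigma_finite (lborel :: real measure) (lborel :: (real \<times> real) measure)" ..
  have gm [measurable]: "g \<in> borel_measurable borel" using g by auto
  have "integral\<^sup>L lborel g = integral\<^sup>L (distr lborel borel (frame_map a b c)) g"
    by (simp add: distr_frame_map_lborel[OF on])
  also have "\<dots> = (\<integral>x. g (frame_map a b c x) \<partial>lborel)"
    by (rule integral_distr) auto
  also have "\<dots> = (\<integral>x. g (frame_map a b c x) \<partial>(lborel \<Otimes>\<^sub>M lborel))"
    by (simp add: lborel_prod)
  also have "\<dots> = (\<integral>r. (\<integral>w. g (frame_map a b c (r, w)) \<partial>lborel) \<partial>lborel)"
  proof (rule pair_sigma_finite.integral_fst'[OF psf, symmetric])
    have "integrable (distr lborel borel (frame_map a b c)) g"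
      by (simp add: distr_frame_map_lborel[OF on] g)
    thus "integrable (lborel \<Otimes>\<^sub>M lborel) (\<lambda>x. g (frame_map a b c x))"
      by (subst (asm) integrable_distr_eq) (auto simp: lborel_prod)
  qed
  finally show ?thesis .
qed

lemma integral_translate:
  fixes F :: "'a::euclidean_space \<Rightarrow> real"
  assumes [measurable]: "F \<in> borel_measurable borel"
  shows "(\<integral>z. F z \<partial>lborel) = (\<integral>w. F (y + w) \<partial>lborel)"
proof -
  have "(\<integral>z. F z \<partial>lborel) = (\<integral>z. F z \<partial>distr lborel borel ((+) y))"
    by (simp add: lborel_distr_plus)
  also have "\<dots> = (\<integral>w. F (y + w) \<partial>lborel)" by (rule integral_distr) auto
  finally show ?thesis .
qed

lemma integral_affine:
  fixes F :: "'a::euclidean_space \<Rightarrow> real"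
  assumes [measurable]: "F \<in> borel_measurable borel" and c: "c \<noteq> 0"
  shows "(\<integral>z. F z \<partial>lborel) = \<bar>c\<bar> ^ DIM('a) * (\<integral>w. F (y + c *\<^sub>R w) \<partial>lborel)"
proof -
  have "(\<integral>z. F z \<partial>lborel)
     = (\<integral>z. F z \<partial>density (distr lborel borel (\<lambda>x. y + c *\<^sub>R x)) (\<lambda>_. ennreal (\<bar>c\<bar> ^ DIM('a))))"
    using lborel_affine[OF c, of y] by (simp add: ennreal_power)
  also have "\<dots> = \<bar>c\<bar> ^ DIM('a) * (\<integral>z. F z \<partial>distr lborel borel (\<lambda>x. y + c *\<^sub>R x))"
    by (subst integral_density) auto
  also have "(\<integral>z. F z \<partial>distr lborel borel (\<lambda>x. y + c *\<^sub>R x)) = (\<integral>w. F (y + c *\<^sub>R w) \<partial>lborel)"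
    by (rule integral_distr) auto
  finally show ?thesis .
qed

lemma integral_frame_scaled:
  fixes g :: "real^3 \<Rightarrow> real"
  assumes on: "orthonormal3 a b c" and [measurable]: "g \<in> borel_measurable borel" and k: "k \<noteq> 0" "l \<noteq> 0"
  shows "integral\<^sup>L lborel g
    = \<bar>k\<bar> * l\<^sup>2 * (\<integral>(r, p, q). g (m + frame_map a b c (k * r, l * p, l * q)) \<partial>lborel)"
proof -
  define s :: "real \<times> real \<times> real \<Rightarrow> real" where "s = (\<lambda>j. if j = (1, 0, 0) then k else l)"
  let ?T = "\<lambda>x. 0 + (\<Sum>j\<in>Basis. (s j * (x \<bullet> j)) *\<^sub>R j)"
  have T: "?T = (\<lambda>(r, p, q). (k * r, l * p, l * q))"
    by (auto simp: fun_eq_iff Basis_triple s_def)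
  have P: "(\<Prod>j\<in>Basis. \<bar>s j\<bar>) = \<bar>k\<bar> * l\<^sup>2"
    by (simp add: Basis_triple s_def power2_eq_square)
  have sm [measurable]: "(\<lambda>(r, p, q). (k * r, l * p, l * q)) \<in> borel_measurable borel"
    unfolding split_beta by (intro borel_measurable_continuous_onI continuous_intros)
  have aff: "(lborel :: (real \<times> real \<times> real) measure)
      = density (distr lborel borel (\<lambda>(r, p, q). (k * r, l * p, l * q))) (\<lambda>_. ennreal (\<bar>k\<bar> * l\<^sup>2))"
    using lborel_affine_euclidean[of s 0] k unfolding T P by (simp add: s_def)
  have "integral\<^sup>L lborel g = (\<integral>z. g (m + z) \<partial>lborel)" by (rule integral_translate) measurable
  also have "\<dots> = (\<integral>z. g (m + z) \<partial>distr lborel borel (frame_map a b c))"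
    by (simp add: distr_frame_map_lborel[OF on])
  also have "\<dots> = (\<integral>x. g (m + frame_map a b c x) \<partial>lborel)" by (rule integral_distr) auto
  also have "\<dots> = (\<integral>x. g (m + frame_map a b c x) \<partial>density (distr lborel borel (\<lambda>(r, p, q). (k * r, l
    * p, l * q))) (\<lambda>_. ennreal (\<bar>k\<bar> * l\<^sup>2)))"
    using aff by simp
  also have "\<dots> = \<bar>k\<bar> * l\<^sup>2 * (\<integral>x. g (m + frame_map a b c x) \<partial>distr lborel borel (\<lambda>(r, p, q). (k
    * r, l * p, l * q)))"
    by (subst integral_density) auto
  also have "(\<integral>x. g (m + frame_map a b c x) \<partial>distr lborel borel (\<lambda>(r, p, q). (k * r, l * p, l * q)))
     = (\<integral>(r, p, q). g (m + frame_map a b c (k * r, l * p, l * q)) \<partial>lborel)"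
    using sm by (subst integral_distr) (auto simp: case_prod_unfold)
  finally show ?thesis .
qed

section \<open>Injectivity of the Radon transform\<close>

lemma radon_eq:
  assumes g: "continuous_on UNIV g" and "norm \<theta> = 1"
  shows "radon g r \<theta>
    = (\<integral>w. g (frame_map \<theta> (fst (plane_basis \<theta>)) (snd (plane_basis \<theta>)) (r, w)) \<partial>lborel)"
proof -
  let ?u = "fst (plane_basis \<theta>)" and ?v = "snd (plane_basis \<theta>)"
  have on: "orthonormal3 \<theta> ?u ?v" by (rule plane_basis_orthonormal) fact
  have [measurable]: "g \<in> borel_measurable borel" by (rule borel_measurable_continuous_onI) fact
  have pm: "plane_measure r \<theta> = distr lborel borel (\<lambda>w. frame_map \<theta> ?u ?v (r, w))"
    by (simp add: plane_measure_def frame_map_def case_prod_unfold)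
  have "closed (plane r \<theta>)"
    unfolding plane_def using closed_hyperplane[of \<theta> r] by (simp add: inner_commute)
  hence [measurable]: "plane r \<theta> \<in> sets borel" by auto
  have [measurable]: "(\<lambda>w. frame_map \<theta> ?u ?v (r, w)) \<in> borel_measurable borel"
    unfolding frame_map_def split_beta
    by (intro borel_measurable_continuous_onI continuous_intros)
  have in_plane: "frame_map \<theta> ?u ?v (r, w) \<in> plane r \<theta>" for w
    using on by (cases w) (simp add: frame_map_def plane_def orthonormal3_def inner_add_left 
       inner_add_right inner_commute norm_eq_1)
  show ?thesis
    unfolding radon_def set_lebesgue_integral_def pm
    by (subst integral_distr) (auto simp: in_plane)
qed

text \<open>The planes \<open>y \<bullet> \<theta> = r\<close> and \<open>y \<bullet> (- \<theta>) = - r\<close> coincide, so nonnegative \<open>r\<close> are enough. The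
defining property of \<open>plane_basis\<close> does not distinguish \<open>\<theta>\<close> from \<open>- \<theta>\<close>, so even the chosen
bases agree.\<close>

lemma radon_minus: "radon g (- r) (- \<theta>) = radon g r \<theta>"
proof -
  have "plane_basis (- \<theta>) = plane_basis \<theta>" by (simp add: plane_basis_def)
  moreover have "plane (- r) (- \<theta>) = plane r \<theta>" by (auto simp: plane_def)
  ultimately show ?thesis by (simp add: radon_def plane_measure_def)
qed

lemma integral_exp_eq_0_of_radon:
  assumes g: "C_k_c 0 g" and R: "\<And>r \<theta>. r \<ge> 0 \<Longrightarrow> \<theta> \<in> sphere 0 1 \<Longrightarrow> radon g r \<theta> = 0"
  shows "(\<integral>y. g y * exp (y \<bullet> \<xi>) \<partial>lborel) = 0"
proof -
  have cont: "continuous_on UNIV g" and comp: "compact (supp g)" using g by (auto simp: C_k_c_0_iff)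
  obtain \<theta> k where th: "norm \<theta> = 1" "\<xi> = k *\<^sub>R \<theta>"
  proof (cases "\<xi> = 0")
    case True
    thus ?thesis using that[of "axis 1 1" 0] by simp
  next
    case False
    thus ?thesis using that[of "\<xi> /\<^sub>R norm \<xi>" "norm \<xi>"] by simp
  qed
  have R0: "radon g r \<theta> = 0" for r
    using R[of r \<theta>] R[of "-r" "-\<theta>"] radon_minus[of g r \<theta>] th by (cases "r \<ge> 0") auto
  let ?F = "frame_map \<theta> (fst (plane_basis \<theta>)) (snd (plane_basis \<theta>))"
  have on: "orthonormal3 \<theta> (fst (plane_basis \<theta>)) (snd (plane_basis \<theta>))"
    by (rule plane_basis_orthonormal) fact
  have inn: "?F (r, w) \<bullet> \<xi> = k * r" for r w
    using on by (cases w) (simp add: frame_map_def orthonormal3_def inner_add_left 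
       inner_add_right inner_commute norm_eq_1 th(2))
  have "integrable lborel (\<lambda>y. g y * exp (y \<bullet> \<xi>))"
    by (rule integrable_continuous_compact[OF _ comp])
       (auto intro!: continuous_intros cont simp: not_in_supp)
  hence "(\<integral>y. g y * exp (y \<bullet> \<xi>) \<partial>lborel)
     = (\<integral>r. (\<integral>w. g (?F (r, w)) * exp (k * r) \<partial>lborel) \<partial>lborel)"
    by (subst integral_frame[OF on]) (simp_all add: inn)
  also have "\<dots> = (\<integral>r. radon g r \<theta> * exp (k * r) \<partial>lborel)"
    by (simp add: radon_eq[OF cont th(1)])
  finally show ?thesis by (simp add: R0)
qed

text \<open>The linear span of the exponentials \<open>exp (y \<bullet> \<xi>)\<close>; it is closed under multiplication.\<close>

inductive_set exp_span :: "(real^3 \<Rightarrow> real) set" where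
  base: "(\<lambda>y. c * exp (y \<bullet> \<xi>)) \<in> exp_span"
| add: "p \<in> exp_span \<Longrightarrow> q \<in> exp_span \<Longrightarrow> (\<lambda>y. p y + q y) \<in> exp_span"

lemma exp_span_continuous: "p \<in> exp_span \<Longrightarrow> continuous_on S p"
  by (induction rule: exp_span.induct) (auto intro!: continuous_intros)

lemma exp_span_mult:
  assumes "p \<in> exp_span" "q \<in> exp_span"
  shows "(\<lambda>y. p y * q y) \<in> exp_span"
  using assms(1)
proof (induction rule: exp_span.induct)
  case (base c \<xi>)
  from assms(2) show ?case
  proof (induction rule: exp_span.induct)
    case (base c' \<xi>')
    have "(\<lambda>y. c * exp (y \<bullet> \<xi>) * (c' * exp (y \<bullet> \<xi>'))) = (\<lambda>y. (c * c') * exp (y \<bullet> (\<xi> + \<xi>')))"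
      by (simp add: inner_add_right exp_add mult_ac)
    thus ?case using exp_span.base by simp
  next
    case (add p q)
    from exp_span.add[OF add.IH] show ?case by (simp add: distrib_left)
  qed
next
  case (add p q)
  from exp_span.add[OF add.IH] show ?case by (simp add: distrib_right)
qed

lemma radon_injective:
  assumes g: "C_k_c 0 g" and R: "\<And>r \<theta>. r \<ge> 0 \<Longrightarrow> \<theta> \<in> sphere 0 1 \<Longrightarrow> radon g r \<theta> = 0"
  shows "g = (\<lambda>y. 0)"
proof -
  have cont: "continuous_on UNIV g" and comp: "compact (supp g)" using g by (auto simp: C_k_c_0_iff)
  have out: "z \<notin> supp g \<Longrightarrow> g z = 0" for z by (rule not_in_supp)
  have gi: "integrable lborel (\<lambda>y. g y * p y)" if "continuous_on UNIV p" for p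
    by (rule integrable_continuous_compact[OF _ comp]) (auto intro!: continuous_intros cont that simp: out)
  have span0: "(\<integral>y. g y * p y \<partial>lborel) = 0" if "p \<in> exp_span" for p
    using that
  proof (induction rule: exp_span.induct)
    case (base c \<xi>)
    have "(\<integral>y. g y * (c * exp (y \<bullet> \<xi>)) \<partial>lborel) = (\<integral>y. c * (g y * exp (y \<bullet> \<xi>)) \<partial>lborel)"
      by (simp add: mult_ac)
    also have "\<dots> = 0" using integral_exp_eq_0_of_radon[OF g R] by simp
    finally show ?case .
  next
    case (add p q)
    thus ?case
      using gi[OF exp_span_continuous[OF add.hyps(1)]] gi[OF exp_span_continuous[OF add.hyps(2)]]
      by (simp add: distrib_left)
  qed
  interpret function_ring_on exp_span "supp g"
  proof
    show "(\<lambda>_. c) \<in> exp_span" for c using exp_span.base[of c 0] by simp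
    fix x y :: "real^3" assume "x \<noteq> y"
    hence "(x - y) \<bullet> (x - y) \<noteq> 0" by simp
    hence "x \<bullet> (x - y) \<noteq> y \<bullet> (x - y)" by (simp add: inner_diff_left)
    hence "1 * exp (x \<bullet> (x - y)) \<noteq> 1 * exp (y \<bullet> (x - y))" by simp
    thus "\<exists>f\<in>exp_span. f x \<noteq> f y" by (rule bexI[OF _ exp_span.base])
  qed (fact comp | erule (1) exp_span.add | erule (1) exp_span_mult | erule exp_span_continuous)+
  have absi: "integrable lborel (\<lambda>y. \<bar>g y\<bar>)" using gi[of "\<lambda>_. 1"] by simp
  let ?I = "\<integral>y. g y * g y \<partial>lborel"
  let ?N = "\<integral>y. \<bar>g y\<bar> \<partial>lborel"
  \<comment> \<open>Approximating \<open>g\<close> on its support by elements of the span shows that \<open>g\<close> is orthogonal to itself.\<close>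
  have "?I \<le> e * ?N" if "e > 0" for e
  proof -
    obtain p where p: "p \<in> exp_span" "\<And>y. y \<in> supp g \<Longrightarrow> \<bar>g y - p y\<bar> < e"
      using Stone_Weierstrass_basic[OF continuous_on_subset[OF cont] \<open>e > 0\<close>] by auto
    have pc: "continuous_on UNIV p" using p(1) by (rule exp_span_continuous)
    have "?I = (\<integral>y. g y * g y \<partial>lborel) - (\<integral>y. g y * p y \<partial>lborel)" by (simp add: span0 p)
    also have "\<dots> = (\<integral>y. g y * g y - g y * p y \<partial>lborel)"
      by (rule Bochner_Integration.integral_diff[symmetric]) (auto intro!: gi cont pc)
    also have "\<dots> \<le> (\<integral>y. e * \<bar>g y\<bar> \<partial>lborel)"
    proof (rule integral_mono)
      show "integrable lborel (\<lambda>y. g y * g y - g y * p y)"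
        by (intro Bochner_Integration.integrable_diff gi cont pc)
      show "integrable lborel (\<lambda>y. e * \<bar>g y\<bar>)" using absi by simp
      fix y
      have "g y * g y - g y * p y \<le> \<bar>g y\<bar> * \<bar>g y - p y\<bar>"
        by (metis abs_ge_self abs_mult right_diff_distrib)
      also have "\<dots> \<le> \<bar>g y\<bar> * e"
        using p(2)[of y] out[of y] by (cases "y \<in> supp g") (auto intro!: mult_left_mono)
      finally show "g y * g y - g y * p y \<le> e * \<bar>g y\<bar>" by (simp add: mult.commute)
    qed
    finally show ?thesis by simp
  qed
  hence "?I \<le> 0" 
  proof -
    assume *: "\<And>e. e > 0 \<Longrightarrow> ?I \<le> e * ?N"
    have "((\<lambda>e. e * ?N) \<longlongrightarrow> 0 * ?N) (at_right 0)" by (intro tendsto_intros)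
    moreover have "eventually (\<lambda>e. ?I \<le> e * ?N) (at_right 0)"
      using * by (auto simp: eventually_at_right_less eventually_at_filter)
    ultimately show ?thesis using tendsto_lowerbound[of "\<lambda>e. e * ?N" "0 * ?N" "at_right 0" ?I] by simp
  qed
  moreover have "?I \<ge> 0" by (rule Bochner_Integration.integral_nonneg) simp
  ultimately have "?I = 0" by simp
  hence "AE y in lborel. g y * g y = 0"
    by (subst (asm) integral_nonneg_eq_0_iff_AE) (auto intro!: gi cont)
  hence "AE y in lborel. g y = 0" by simp
  moreover have op: "open {y. g y \<noteq> 0}"
    using open_Collect_neq[OF cont continuous_on_const[of _ 0]] by simp
  ultimately have "{y. g y \<noteq> 0} \<in> null_sets lborel"
    by (subst (asm) AE_iff_null) (auto intro: borel_open)
  with op have "{y. g y \<noteq> 0} = {}"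
    using open_not_negligible[of "{y. g y \<noteq> 0}"] by (auto simp: negligible_iff_null_sets null_sets_completionI)
  thus ?thesis by auto
qed

lemma radon_diff:
  assumes "C_k_c 0 g" "C_k_c 0 h" "norm \<theta> = 1"
  shows "radon (\<lambda>y. g y - h y) r \<theta> = radon g r \<theta> - radon h r \<theta>"
proof -
  let ?F = "\<lambda>w. frame_map \<theta> (fst (plane_basis \<theta>)) (snd (plane_basis \<theta>)) (r, w)"
  have on: "orthonormal3 \<theta> (fst (plane_basis \<theta>)) (snd (plane_basis \<theta>))"
    by (rule plane_basis_orthonormal) fact
  have i: "integrable lborel (\<lambda>w. k (?F w))" if k: "C_k_c 0 k" for k
  proof -
    have cont: "continuous_on UNIV k" and comp: "compact (supp k)" using k by (auto simp: C_k_c_0_iff)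
    obtain B where B: "\<And>z. z \<in> supp k \<Longrightarrow> norm z \<le> B" using comp compact_imp_bounded bounded_iff by metis
    have cF: "continuous_on UNIV ?F" unfolding frame_map_def split_beta by (intro continuous_intros)
    show ?thesis
    proof (rule integrable_continuous_compact[of _ "cball 0 B"])
      show "continuous_on UNIV (\<lambda>w. k (?F w))"
        using continuous_on_compose2[OF cont cF] by simp
      fix w :: "real \<times> real" assume w: "w \<notin> cball 0 B"
      have "norm w ^ 2 \<le> norm (?F w) ^ 2"
        by (cases w) (simp add: norm_frame_map[OF on] norm_Pair)
      hence "norm w \<le> norm (?F w)" by (rule power2_le_imp_le) simp
      hence "?F w \<notin> supp k" using w B[of "?F w"] by auto
      thus "k (?F w) = 0" by (rule not_in_supp)
    qed auto
  qed
  have c: "continuous_on UNIV g" "continuous_on UNIV h" "continuous_on UNIV (\<lambda>y. g y - h y)" 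
    using assms by (auto simp: C_k_c_0_iff intro!: continuous_intros)
  show ?thesis
    using i[OF assms(1)] i[OF assms(2)] by (simp add: radon_eq c assms(3))
qed

lemma radon_inv_eqI:
  assumes g: "C_k_c 0 g" and m: "\<And>r \<theta>. r \<ge> 0 \<Longrightarrow> \<theta> \<in> sphere 0 1 \<Longrightarrow> radon g r \<theta> = m r \<theta>"
  shows "radon_inv m = g"
  unfolding radon_inv_def
proof (rule the_equality)
  fix h assume h: "C_k_c 0 h \<and> (\<forall>r\<ge>0. \<forall>\<theta>\<in>sphere 0 1. radon h r \<theta> = m r \<theta>)"
  have "C_k_c 0 (\<lambda>y. h y - g y)"
    unfolding C_k_c_0_iff
  proof
    show "continuous_on UNIV (\<lambda>y. h y - g y)"
      using h g by (auto simp: C_k_c_0_iff intro!: continuous_intros)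
    show "compact (supp (\<lambda>y. h y - g y))"
      using h g by (intro compact_suppI[of _ "supp h \<union> supp g"]) (auto simp: C_k_c_0_iff, metis not_in_supp)
  qed
  hence "(\<lambda>y. h y - g y) = (\<lambda>y. 0)"
    by (rule radon_injective) (use h g m in \<open>simp add: radon_diff\<close>)
  thus "h = g" by (auto simp: fun_eq_iff)
qed (use g m in auto)

section \<open>Parameter-dependent integrals\<close>

text \<open>Continuity under the integral sign, by dominated convergence.\<close>

lemma isCont_integral:
  fixes F :: "'p::metric_space \<Rightarrow> 'a \<Rightarrow> real"
  assumes cont: "AE z in M. isCont (\<lambda>p. F p z) p0"
    and meas: "\<And>p. F p \<in> borel_measurable M"
    and bnd: "\<And>p z. \<bar>F p z\<bar> \<le> C z" and C: "integrable M C"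
  shows "isCont (\<lambda>p. \<integral>z. F p z \<partial>M) p0"
  unfolding continuous_at_sequentially
proof (intro allI impI)
  fix X assume X: "X \<longlonglongrightarrow> p0"
  have "(\<lambda>n. \<integral>z. F (X n) z \<partial>M) \<longlonglongrightarrow> (\<integral>z. F p0 z \<partial>M)"
  proof (rule integral_dominated_convergence[where w = C])
    show "AE z in M. (\<lambda>n. F (X n) z) \<longlonglongrightarrow> F p0 z"
      using cont by eventually_elim (rule isCont_tendsto_compose[OF _ X])
  qed (use meas bnd C in auto)
  thus "((\<lambda>p. \<integral>z. F p z \<partial>M) \<circ> X) \<longlonglongrightarrow> (\<integral>z. F p0 z \<partial>M)" by (simp add: comp_def)
qed

text \<open>Differentiation under the integral sign. The integrand needs to be differentiable at the one
point \<open>t0\<close> only, for almost all \<open>z\<close>; the Lipschitz bound around \<open>t0\<close> provides the dominating function.\<close>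

lemma has_real_derivative_integral:
  fixes F :: "real \<Rightarrow> 'a \<Rightarrow> real"
  assumes e: "e > 0" and int: "\<And>t. \<bar>t - t0\<bar> < e \<Longrightarrow> integrable M (F t)"
    and deriv: "AE z in M. ((\<lambda>t. F t z) has_real_derivative F' z) (at t0)"
    and lip: "\<And>t z. \<bar>t - t0\<bar> < e \<Longrightarrow> \<bar>F t z - F t0 z\<bar> \<le> C z * \<bar>t - t0\<bar>"
    and C: "integrable M C" and F': "F' \<in> borel_measurable M"
  shows "((\<lambda>t. \<integral>z. F t z \<partial>M) has_real_derivative (\<integral>z. F' z \<partial>M)) (at t0)"
  unfolding has_field_derivative_iff tendsto_at_iff_sequentially
proof (intro allI impI)
  fix X assume X0: "\<forall>i. X i \<in> UNIV - {t0}" and X: "X \<longlonglongrightarrow> t0"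
  let ?I = "\<lambda>t. \<integral>z. F t z \<partial>M"
  from X e obtain N where N: "\<And>n. n \<ge> N \<Longrightarrow> \<bar>X n - t0\<bar> < e"
    by (auto simp: LIMSEQ_def dist_real_def)
  let ?Y = "\<lambda>n. X (n + N)"
  have Y: "\<bar>?Y n - t0\<bar> < e" "?Y n \<noteq> t0" for n using N X0 by auto
  have i0: "integrable M (F t0)" using int[of t0] e by simp
  have "(\<lambda>n. \<integral>z. (F (?Y n) z - F t0 z) / (?Y n - t0) \<partial>M) \<longlonglongrightarrow> (\<integral>z. F' z \<partial>M)"
  proof (rule integral_dominated_convergence[where w = C])
    show "AE z in M. (\<lambda>n. (F (?Y n) z - F t0 z) / (?Y n - t0)) \<longlonglongrightarrow> F' z"
      using deriv
    proof eventually_elim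
      fix z assume "((\<lambda>t. F t z) has_real_derivative F' z) (at t0)"
      hence "(\<lambda>n. (F (X n) z - F t0 z) / (X n - t0)) \<longlonglongrightarrow> F' z"
        using X0 X by (simp add: has_field_derivative_iff tendsto_at_iff_sequentially comp_def)
      thus "(\<lambda>n. (F (?Y n) z - F t0 z) / (?Y n - t0)) \<longlonglongrightarrow> F' z"
        by (rule LIMSEQ_ignore_initial_segment)
    qed
    show "AE z in M. norm ((F (?Y n) z - F t0 z) / (?Y n - t0)) \<le> C z" for n
      using lip[OF Y(1)] Y(2)[of n] by (auto simp: divide_le_eq)
    show "(\<lambda>z. (F (?Y n) z - F t0 z) / (?Y n - t0)) \<in> borel_measurable M" for n
      using int[OF Y(1)] i0 by (intro borel_measurable_divide borel_measurable_diff) auto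
  qed (use C F' in auto)
  also have "(\<lambda>n. \<integral>z. (F (?Y n) z - F t0 z) / (?Y n - t0) \<partial>M) = (\<lambda>n. (?I (?Y n) - ?I t0) / (?Y n - t0))"
    using int[OF Y(1)] i0 by (simp add: integral_divide_zero)
  finally have "(\<lambda>n. (?I (X n) - ?I t0) / (X n - t0)) \<longlonglongrightarrow> (\<integral>z. F' z \<partial>M)"
    by (rule LIMSEQ_offset)
  thus "((\<lambda>t. (?I t - ?I t0) / (t - t0)) \<circ> X) \<longlonglongrightarrow> (\<integral>z. F' z \<partial>M)"
    by (simp add: comp_def)
qed

section \<open>Integrals over ellipsoids\<close>

text \<open>Surfaces of ellipsoids are null sets, including the degenerate case in which the ellipsoid is the
segment between its foci.\<close>

lemma level_set_null:
  fixes x y :: "real^3"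
  shows "AE z in lborel. norm (z - x) + norm (z - y) \<noteq> t"
proof -
  let ?s = "\<lambda>z. norm (z - x) + norm (z - y)"
  have "negligible {z. ?s z = t}"
  proof (cases "t > norm (x - y)")
    case True
    \<comment> \<open>A nondegenerate level set is the frontier of a convex sublevel set.\<close>
    have "convex {z. ?s z \<le> t}"
    proof (rule convexI, unfold mem_Collect_eq)
      fix a b :: "real^3" and u v :: real
      assume ab: "?s a \<le> t" "?s b \<le> t" and uv: "0 \<le> u" "0 \<le> v" "u + v = 1"
      have *: "norm (u *\<^sub>R a + v *\<^sub>R b - w) \<le> u * norm (a - w) + v * norm (b - w)" for w
      proof -
        have "u *\<^sub>R a + v *\<^sub>R b - w = u *\<^sub>R a + v *\<^sub>R b - (u + v) *\<^sub>R w" using uv by simp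
        also have "\<dots> = u *\<^sub>R (a - w) + v *\<^sub>R (b - w)" by (simp add: algebra_simps)
        finally show ?thesis
          using norm_triangle_ineq[of "u *\<^sub>R (a - w)" "v *\<^sub>R (b - w)"] uv by simp
      qed
      have "?s (u *\<^sub>R a + v *\<^sub>R b) \<le> u * ?s a + v * ?s b"
        using *[of x] *[of y] by (simp add: distrib_left)
      also have "\<dots> \<le> u * t + v * t" using ab uv by (intro add_mono mult_left_mono) auto
      also have "\<dots> = t" using uv by (simp add: distrib_right[symmetric])
      finally show "?s (u *\<^sub>R a + v *\<^sub>R b) \<le> t" .
    qed
    hence "negligible (frontier {z. ?s z \<le> t})" by (rule negligible_convex_frontier)
    moreover have "{z. ?s z = t} \<subseteq> frontier {z. ?s z \<le> t}"
    proof
      fix z assume "z \<in> {z. ?s z = t}"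
      hence z: "?s z = t" by simp
      have "z \<notin> interior {z. ?s z \<le> t}"
      proof
        assume "z \<in> interior {z. ?s z \<le> t}"
        then obtain e where e: "e > 0" "ball z e \<subseteq> {z. ?s z \<le> t}"
          unfolding mem_interior by blast
        have zx: "norm (z - x) > 0" using z True by (cases "z = x") auto
        \<comment> \<open>The sum of distances is \<open>t\<close> at \<open>z\<close> and \<open>norm (x - y) < t\<close> at \<open>x\<close>. Being convex, it exceeds \<open>t\<close>
          on the ray from \<open>x\<close> beyond \<open>z\<close>.\<close>
        define h where "h = e / (2 * norm (z - x))"
        have h: "h > 0" using zx e by (simp add: h_def)
        let ?w = "z + h *\<^sub>R (z - x)"
        have "dist z ?w < e" using e zx by (simp add: h_def dist_norm)
        hence w: "?s ?w \<le> t" using e by auto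
        have z_eq: "(1 + h) *\<^sub>R (z - y) = (?w - y) + h *\<^sub>R (x - y)" by (simp add: algebra_simps)
        have "(1 + h) * norm (z - y) = norm ((?w - y) + h *\<^sub>R (x - y))"
          using h unfolding z_eq[symmetric] by simp
        also have "\<dots> \<le> norm (?w - y) + h * norm (x - y)"
          using h norm_triangle_ineq[of "?w - y" "h *\<^sub>R (x - y)"] by simp
        finally have "(1 + h) * norm (z - y) \<le> norm (?w - y) + h * norm (x - y)" .
        moreover have "?w - x = (1 + h) *\<^sub>R (z - x)" by (simp add: algebra_simps)
        hence "norm (?w - x) = (1 + h) * norm (z - x)" using h by simp
        ultimately have "(1 + h) * t \<le> t + h * norm (x - y)"
          using w unfolding z[symmetric] by (simp add: algebra_simps)
        thus False using True h by (simp add: algebra_simps)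
      qed
      moreover have "closed {z. ?s z \<le> t}" by (intro closed_Collect_le continuous_intros)
      ultimately show "z \<in> frontier {z. ?s z \<le> t}" using z by (simp add: frontier_def)
    qed
    ultimately show ?thesis by (rule negligible_subset)
  next
    case False
    \<comment> \<open>For \<open>t \<le> norm (x - y)\<close> the level set degenerates to (part of) the segment between the foci.\<close>
    have "{z. ?s z = t} \<subseteq> closed_segment x y"
    proof
      fix z assume "z \<in> {z. ?s z = t}"
      hence "?s z \<le> norm (x - y)" using False by simp
      hence "dist x y = dist x z + dist z y"
        using dist_triangle[of x y z] by (simp add: dist_norm norm_minus_commute)
      thus "z \<in> closed_segment x y" by (simp add: between_mem_segment[symmetric] between)
    qed
    moreover have "negligible (closed_segment x y)"
      using negligible_convex_interior[OF convex_closed_segment, of x y]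
      by (simp add: interior_closed_segment_ge2)
    ultimately show ?thesis by (rule negligible_subset[rotated])
  qed
  hence "{z. ?s z = t} \<in> null_sets lebesgue" by (simp add: negligible_iff_null_sets)
  moreover have "{z. ?s z = t} \<in> sets borel"
    by (intro borel_closed closed_Collect_eq continuous_intros)
  ultimately have "{z. ?s z = t} \<in> null_sets lborel"
    by (auto simp: null_sets_def)
  thus ?thesis by (intro AE_I'[of "{z. ?s z = t}"]) auto
qed

text \<open>The truncated power \<open>(t - s) ^ j\<close>. For \<open>j = 0\<close> it is the indicator of \<open>s \<le> t\<close>.\<close>

definition trunc_power :: "nat \<Rightarrow> real \<Rightarrow> real \<Rightarrow> real" where
  "trunc_power j t s = (if s \<le> t then (t - s) ^ j else 0)"

lemma trunc_power_measurable [measurable]: "trunc_power j t \<in> borel_measurable borel"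
  unfolding trunc_power_def by measurable

lemma trunc_power_bound: "0 \<le> s \<Longrightarrow> \<bar>trunc_power j t s\<bar> \<le> \<bar>t\<bar> ^ j"
  by (auto simp: trunc_power_def power_abs intro!: power_mono)

lemma isCont_trunc_power: "s \<noteq> t \<Longrightarrow> isCont (trunc_power j t) s"
proof (cases "s < t")
  case True
  have "isCont (\<lambda>s. (t - s) ^ j) s" by (intro continuous_intros)
  moreover have "eventually (\<lambda>s. trunc_power j t s = (t - s) ^ j) (nhds s)"
    using eventually_nhds_in_open[of "{..<t}" s] True
    by (auto simp: trunc_power_def elim!: eventually_mono)
  ultimately show ?thesis using isCont_cong by force
next
  case False
  moreover assume "s \<noteq> t"
  ultimately have "eventually (\<lambda>s. trunc_power j t s = 0) (nhds s)"
    using eventually_nhds_in_open[of "{t<..}" s]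
    by (auto simp: trunc_power_def elim!: eventually_mono)
  thus ?thesis using isCont_cong[of "trunc_power j t" "\<lambda>_. 0"] by force
qed

lemma has_real_derivative_trunc_power:
  assumes "t0 \<noteq> s"
  shows "((\<lambda>t. trunc_power (Suc j) t s) has_real_derivative (real (Suc j) * trunc_power j t0 s)) (at t0)"
proof (cases "s < t0")
  case True
  have "((\<lambda>t. t - s) has_real_derivative 1) (at t0)" by (auto intro!: derivative_eq_intros)
  from DERIV_power[OF this, of "Suc j"]
  have "((\<lambda>t. (t - s) ^ Suc j) has_real_derivative (real (Suc j) * (t0 - s) ^ j)) (at t0)"
    by (simp del: power_Suc of_nat_Suc)
  hence "((\<lambda>t. trunc_power (Suc j) t s) has_real_derivative (real (Suc j) * (t0 - s) ^ j)) (at t0)"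
    by (rule has_field_derivative_transform_within_open[of _ _ _ "{s<..}"])
       (use True in \<open>auto simp: trunc_power_def\<close>)
  thus ?thesis using True by (simp add: trunc_power_def)
next
  case False
  have "((\<lambda>t. 0) has_real_derivative 0) (at t0)" by simp
  hence "((\<lambda>t. trunc_power (Suc j) t s) has_real_derivative 0) (at t0)"
    by (rule has_field_derivative_transform_within_open[of _ _ _ "{..<s}"])
       (use False assms in \<open>auto simp: trunc_power_def\<close>)
  thus ?thesis using False assms by (simp add: trunc_power_def)
qed

lemma trunc_power_Lipschitz:
  assumes "0 \<le> s" "\<bar>t - t0\<bar> < 1"
  shows "\<bar>trunc_power (Suc j) t s - trunc_power (Suc j) t0 s\<bar> \<le> real (Suc j) * (\<bar>t0\<bar> + 1) ^ j * \<bar>t - t0\<bar>"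
proof -
  define a b where "a = max 0 (t - s)" and "b = max 0 (t0 - s)"
  have tp: "trunc_power (Suc j) t s = a ^ Suc j" "trunc_power (Suc j) t0 s = b ^ Suc j"
    by (auto simp: trunc_power_def a_def b_def max_def)
  have ab: "0 \<le> a" "0 \<le> b" "a \<le> \<bar>t0\<bar> + 1" "b \<le> \<bar>t0\<bar> + 1" "\<bar>a - b\<bar> \<le> \<bar>t - t0\<bar>"
    using assms by (auto simp: a_def b_def)
  have "a ^ Suc j - b ^ Suc j = (a - b) * (\<Sum>p<Suc j. a ^ p * b ^ (j - p))"
    by (rule diff_power_eq_sum)
  moreover have "0 \<le> (\<Sum>p<Suc j. a ^ p * b ^ (j - p))"
    by (intro sum_nonneg mult_nonneg_nonneg zero_le_power ab)
  ultimately have "\<bar>a ^ Suc j - b ^ Suc j\<bar> = \<bar>a - b\<bar> * (\<Sum>p<Suc j. a ^ p * b ^ (j - p))"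
    by (simp only: abs_mult abs_of_nonneg)
  also have "\<dots> \<le> \<bar>t - t0\<bar> * (\<Sum>p<Suc j. (\<bar>t0\<bar> + 1) ^ j)"
  proof (intro mult_mono sum_mono ab(5))
    fix p assume "p \<in> {..<Suc j}"
    hence "(\<bar>t0\<bar> + 1) ^ j = (\<bar>t0\<bar> + 1) ^ p * (\<bar>t0\<bar> + 1) ^ (j - p)" by (simp add: power_add[symmetric])
    thus "a ^ p * b ^ (j - p) \<le> (\<bar>t0\<bar> + 1) ^ j"
      using ab by (auto intro!: mult_mono power_mono)
  qed (auto intro!: sum_nonneg mult_nonneg_nonneg zero_le_power ab simp del: sum.lessThan_Suc)
  finally show ?thesis by (simp add: tp mult_ac)
qed

text \<open>The integral over the ellipsoid with foci \<open>x\<close>, \<open>y\<close> of a density \<open>k\<close>, weighted by the \<open>j\<close>-th power of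
the difference between \<open>t\<close> and the sum of the distances to the foci. The three integrals in the
kernel are of this form with \<open>j\<close> equal to 0, 1 and 2.\<close>

definition ell_int :: "nat \<Rightarrow> real \<Rightarrow> real^3 \<Rightarrow> real^3 \<Rightarrow> (real^3 \<Rightarrow> real) \<Rightarrow> real" where
  "ell_int j t x y k = (\<integral>z. trunc_power j t (norm (z - x) + norm (z - y)) * k z \<partial>lborel)"

lemma trunc_power_integrable:
  assumes k: "integrable lborel k"
  shows "integrable lborel (\<lambda>z. trunc_power j t (norm (z - x) + norm (z - y)) * k z)"
proof (rule Bochner_Integration.integrable_bound)
  show "integrable lborel (\<lambda>z. \<bar>t\<bar> ^ j * \<bar>k z\<bar>)" using k by simp
  have "norm (trunc_power j t (norm (z - x) + norm (z - y)) * k z) \<le> norm (\<bar>t\<bar> ^ j * \<bar>k z\<bar>)" for z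
    using trunc_power_bound[of "norm (z - x) + norm (z - y)" j t]
    by (simp add: abs_mult mult_right_mono)
  thus "AE z in lborel. norm (trunc_power j t (norm (z - x) + norm (z - y)) * k z) \<le> norm (\<bar>t\<bar> ^ j
    * \<bar>k z\<bar>)" by simp
  show "(\<lambda>z. trunc_power j t (norm (z - x) + norm (z - y)) * k z) \<in> borel_measurable lborel"
    using k by measurable
qed

text \<open>An ellipsoid that is empty or degenerate contributes nothing.\<close>

lemma ell_int_eq_0:
  assumes "t \<le> norm (y - x)"
  shows "ell_int j t x y k = 0"
  unfolding ell_int_def
proof (rule integral_eq_zero_AE)
  show "AE z in lborel. trunc_power j t (norm (z - x) + norm (z - y)) * k z = 0"
    using level_set_null[of x y t]
  proof eventually_elim
    fix z assume "norm (z - x) + norm (z - y) \<noteq> t"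
    hence "norm (z - x) + norm (z - y) > t"
      using assms norm_triangle_ineq4[of "z - x" "z - y"] by simp
    thus "trunc_power j t (norm (z - x) + norm (z - y)) * k z = 0" by (simp add: trunc_power_def)
  qed
qed

lemma isCont_ell_int_0:
  assumes k: "integrable lborel k"
  shows "isCont (\<lambda>t. ell_int 0 t x y k) t0"
  unfolding ell_int_def
proof (rule isCont_integral[where C = "\<lambda>z. \<bar>k z\<bar>"])
  let ?s = "\<lambda>z. norm (z - x) + norm (z - y)"
  show "AE z in lborel. isCont (\<lambda>t. trunc_power 0 t (?s z) * k z) t0"
    using level_set_null[of x y t0]
  proof eventually_elim
    fix z assume "?s z \<noteq> t0"
    hence "eventually (\<lambda>t. trunc_power 0 t (?s z) = trunc_power 0 t0 (?s z)) (nhds t0)"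
      using eventually_nhds_in_open[of "if ?s z < t0 then {?s z<..} else {..<?s z}" t0]
      by (auto simp: trunc_power_def elim!: eventually_mono split: if_splits)
    hence "isCont (\<lambda>t. trunc_power 0 t (?s z)) t0"
      using isCont_cong[of "\<lambda>t. trunc_power 0 t (?s z)" "\<lambda>_. trunc_power 0 t0 (?s z)"] by force
    thus "isCont (\<lambda>t. trunc_power 0 t (?s z) * k z) t0" by (intro continuous_intros)
  qed
  show "(\<lambda>z. trunc_power 0 t (?s z) * k z) \<in> borel_measurable lborel" for t
    using k by measurable
  show "\<bar>trunc_power 0 t (?s z) * k z\<bar> \<le> \<bar>k z\<bar>" for t z
    by (auto simp: trunc_power_def)
qed (use k in simp)

lemma has_real_derivative_ell_int:
  assumes k: "integrable lborel k"
  shows "((\<lambda>t. ell_int (Suc j) t x y k) has_real_derivative (real (Suc j) * ell_int j t0 x y k)) (at t0)"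
proof -
  let ?s = "\<lambda>z. norm (z - x) + norm (z - y)"
  have [measurable]: "k \<in> borel_measurable borel" using k by auto
  have "((\<lambda>t. \<integral>z. trunc_power (Suc j) t (?s z) * k z \<partial>lborel) has_real_derivative
     (\<integral>z. real (Suc j) * trunc_power j t0 (?s z) * k z \<partial>lborel)) (at t0)"
  proof (rule has_real_derivative_integral[of 1 _ _ _ _ "\<lambda>z. real (Suc j) * (\<bar>t0\<bar> + 1) ^ j * \<bar>k z\<bar>"])
    show "AE z in lborel. ((\<lambda>t. trunc_power (Suc j) t (?s z) * k z) has_real_derivative
        real (Suc j) * trunc_power j t0 (?s z) * k z) (at t0)"
      using level_set_null[of x y t0]
      by eventually_elim (intro DERIV_cmult_right has_real_derivative_trunc_power, simp)
    fix t z assume t: "\<bar>t - t0\<bar> < (1::real)"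
    have "\<bar>trunc_power (Suc j) t (?s z) * k z - trunc_power (Suc j) t0 (?s z) * k z\<bar>
        = \<bar>trunc_power (Suc j) t (?s z) - trunc_power (Suc j) t0 (?s z)\<bar> * \<bar>k z\<bar>"
      by (simp add: abs_mult[symmetric] left_diff_distrib)
    also have "\<dots> \<le> (real (Suc j) * (\<bar>t0\<bar> + 1) ^ j * \<bar>t - t0\<bar>) * \<bar>k z\<bar>"
      by (intro mult_right_mono trunc_power_Lipschitz t) auto
    finally show "\<bar>trunc_power (Suc j) t (?s z) * k z - trunc_power (Suc j) t0 (?s z) * k z\<bar>
       \<le> real (Suc j) * (\<bar>t0\<bar> + 1) ^ j * \<bar>k z\<bar> * \<bar>t - t0\<bar>" by (simp add: mult_ac)
  qed (use k in \<open>auto intro!: trunc_power_integrable\<close>)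
  thus ?thesis by (simp only: ell_int_def mult.assoc integral_mult_right_zero)
qed

lemma ell_int_large:
  assumes "\<And>z. k z \<noteq> 0 \<Longrightarrow> norm z \<le> R" and "2 * R + norm x + norm y \<le> t"
  shows "ell_int j t x y k = (\<integral>z. (t - (norm (z - x) + norm (z - y))) ^ j * k z \<partial>lborel)"
  unfolding ell_int_def
proof (rule Bochner_Integration.integral_cong)
  fix z
  show "trunc_power j t (norm (z - x) + norm (z - y)) * k z = (t - (norm (z - x) + norm (z - y))) ^ j * k z"
  proof (cases "k z = 0")
    case False
    have "norm (z - x) + norm (z - y) \<le> 2 * R + norm x + norm y"
      using assms(1)[OF False] norm_triangle_ineq4[of z x] norm_triangle_ineq4[of z y] by simp
    thus ?thesis using assms(2) by (simp add: trunc_power_def)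
  qed simp
qed simp

lemma inverse_square_integrable:
  "integrable lborel (\<lambda>w::real^3. indicator (cball 0 R) w * (1 / (norm w)\<^sup>2))"
proof (cases "R > 0")
  case False
  have "(\<lambda>w::real^3. indicator (cball 0 R) w * (1 / (norm w)\<^sup>2)) = (\<lambda>w. 0 :: real)"
    using False by (auto simp: indicator_def fun_eq_iff)
      (metis norm_ge_zero norm_eq_zero order.trans linorder_not_less order_antisym)
  thus ?thesis by simp
next
  case R: True
  \<comment> \<open>On the dyadic shell \<open>R / 2 ^ (n + 1) < norm w \<le> R / 2 ^ n\<close> the integrand is at most
    \<open>4 ^ (n + 1) / R\<^sup>2\<close>, and the volume of that shell is \<open>O(8 ^ - n)\<close>.\<close>
  let ?f = "\<lambda>n w::real^3. ennreal (4 ^ (n + 1) / R\<^sup>2) * indicator (cball 0 (R / 2 ^ n)) w"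
  have pw: "ennreal (indicator (cball 0 R) w * (1 / (norm w)\<^sup>2)) \<le> (\<Sum>n. ?f n w)" for w :: "real^3"
  proof (cases "w \<in> cball 0 R \<and> w \<noteq> 0")
    case True
    hence w: "0 < norm w" "norm w \<le> R" by auto
    have "\<exists>n. R / 2 ^ n < norm w"
    proof -
      obtain n where "R / norm w < 2 ^ n" using real_arch_pow[of 2 "R / norm w"] by auto
      thus ?thesis using w by (auto simp: field_simps)
    qed
    then obtain n where n: "R / 2 ^ n < norm w" "\<And>m. m < n \<Longrightarrow> \<not> R / 2 ^ m < norm w"
      using exists_least_iff[of "\<lambda>n. R / 2 ^ n < norm w"] by blast
    have "n \<noteq> 0" using n(1) w by (intro notI) simp
    then obtain k where k: "n = Suc k" by (cases n) auto
    have in_k: "norm w \<le> R / 2 ^ k" using n(2)[of k] k by simp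
    have "(R / 2 ^ n)\<^sup>2 \<le> (norm w)\<^sup>2" using n(1) R by (intro power_mono) auto
    moreover have "(R / 2 ^ n)\<^sup>2 = R\<^sup>2 / 4 ^ (k + 1)"
      by (simp add: k power_divide power_mult[symmetric] power2_eq_square power_mult_distrib[symmetric])
    ultimately have "1 / (norm w)\<^sup>2 \<le> 4 ^ (k + 1) / R\<^sup>2"
      using w R by (simp add: field_simps)
    hence "ennreal (indicator (cball 0 R) w * (1 / (norm w)\<^sup>2)) \<le> ?f k w"
      using w in_k by (auto simp: indicator_def intro!: ennreal_leI)
    also have "\<dots> \<le> (\<Sum>n. ?f n w)"
      using sum_le_suminf[of "\<lambda>n. ?f n w" "{k}"] by (auto simp del: sum_mult_indicator)
    finally show ?thesis .
  qed (auto simp: indicator_def)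
  have "(\<integral>\<^sup>+(w::real^3). ennreal (indicator (cball 0 R) w * (1 / (norm w)\<^sup>2)) \<partial>lborel)
      \<le> (\<integral>\<^sup>+w. (\<Sum>n. ?f n w) \<partial>(lborel :: (real^3) measure))"
    by (rule nn_integral_mono) (rule pw)
  also have "\<dots> = (\<Sum>n. \<integral>\<^sup>+w. ?f n w \<partial>lborel)"
    by (intro nn_integral_suminf borel_measurable_times_ennreal borel_measurable_const
      borel_measurable_indicator) simp
  also have "\<dots> = (\<Sum>n. ennreal (4 * R * unit_ball_vol 3 * (1/2) ^ n))"
  proof (rule arg_cong[where f = suminf], rule ext)
    fix n
    have "(\<integral>\<^sup>+w. ?f n w \<partial>lborel) = ennreal (4 ^ (n + 1) / R\<^sup>2)
      * emeasure lborel (cball (0::real^3) (R / 2 ^ n))"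
      by (subst nn_integral_cmult_indicator) auto
    also have "\<dots> = ennreal (4 ^ (n + 1) / R\<^sup>2 * (unit_ball_vol 3 * (R / 2 ^ n) ^ 3))"
      using R by (simp add: emeasure_cball ennreal_mult'[symmetric])
    also have "4 ^ (n + 1) / R\<^sup>2 * (unit_ball_vol 3 * (R / 2 ^ n) ^ 3) = 4 * R * unit_ball_vol 3 * (1/2) ^ n"
    proof -
      have "(2::real) ^ n * 2 ^ n = 4 ^ n" by (simp add: power_mult_distrib[symmetric])
      thus ?thesis using R 
        by (simp add: power_divide power2_eq_square power3_eq_cube field_simps)
    qed
    finally show "(\<integral>\<^sup>+w. ?f n w \<partial>lborel) = ennreal (4 * R * unit_ball_vol 3 * (1/2) ^ n)" .
  qed
  also have "\<dots> = ennreal (\<Sum>n. 4 * R * unit_ball_vol 3 * (1/2) ^ n)"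
    using R by (intro suminf_ennreal2 summable_mult summable_geometric) auto
  also have "\<dots> < \<infinity>" by simp
  finally have fin: "(\<integral>\<^sup>+(w::real^3). ennreal (indicator (cball 0 R) w * (1 / (norm w)\<^sup>2)) \<partial>lborel) < \<infinity>" .
  have [measurable]: "cball (0::real^3) R \<in> sets borel" by simp
  show ?thesis
    by (rule integrableI_nonneg[OF _ _ fin]) auto
qed

text \<open>Continuity in the focus \<open>y\<close> although the density is singular there, with singularity at most
\<open>1 / norm w ^ 2\<close>.\<close>

lemma continuous_ell_int:
  fixes g :: "real^3 \<Rightarrow> 'b::euclidean_space" and \<kappa> :: "real^3 \<Rightarrow> 'b"
  assumes g: "continuous_on UNIV g" and S: "compact S" and out: "\<And>z. z \<notin> S \<Longrightarrow> g z = 0"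
    and km [measurable]: "\<kappa> \<in> borel_measurable borel"
    and kb: "\<And>w. norm (\<kappa> w) \<le> 1 + 1 / (norm w)\<^sup>2"
  shows "continuous_on UNIV (\<lambda>y. ell_int j t x y (\<lambda>z. g z \<bullet> \<kappa> (z - y)))"
proof -
  have gm [measurable]: "g \<in> borel_measurable borel" using g by (rule borel_measurable_continuous_onI)
  \<comment> \<open>After the substitution \<open>z = y + w\<close> the singularity no longer moves with \<open>y\<close>.\<close>
  let ?G = "\<lambda>y w. trunc_power j t (norm (y + w - x) + norm w) * (g (y + w) \<bullet> \<kappa> w)"
  have eq: "ell_int j t x y (\<lambda>z. g z \<bullet> \<kappa> (z - y)) = (\<integral>w. ?G y w \<partial>lborel)" for y
    unfolding ell_int_def by (subst integral_translate[of _ y]) auto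
  obtain M where M: "0 \<le> M" "\<And>z. norm (g z) \<le> M"
    using continuous_supp_bounded[OF g S out] by metis
  obtain RS where RS: "\<And>z. z \<in> S \<Longrightarrow> norm z \<le> RS"
    using S compact_imp_bounded bounded_iff by metis
  have "(\<lambda>n. \<integral>w. ?G (u n) w \<partial>lborel) \<longlonglongrightarrow> (\<integral>w. ?G y w \<partial>lborel)" if u: "u \<longlonglongrightarrow> y" for u y
  proof -
    have "bounded (range u)" using u by (meson convergent_imp_bounded)
    then obtain Y where Y: "\<And>n. norm (u n) \<le> Y" by (auto simp: bounded_iff)
    let ?C = "indicator (cball 0 (Y + RS)) :: real^3 \<Rightarrow> real"
    let ?D = "\<lambda>w. \<bar>t\<bar> ^ j * M * (?C w + ?C w * (1 / (norm w)\<^sup>2))"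
    show ?thesis
    proof (rule integral_dominated_convergence[where w = ?D])
      show "integrable lborel ?D"
        by (intro integrable_mult_right Bochner_Integration.integrable_add inverse_square_integrable
          integrable_real_indicator)
           (auto simp: emeasure_lborel_cball_finite[unfolded infinity_ennreal_def])
      show "AE w in lborel. (\<lambda>n. ?G (u n) w) \<longlonglongrightarrow> ?G y w"
        using level_set_null[of "x - y" 0 t]
      proof eventually_elim
        fix w assume "norm (w - (x - y)) + norm (w - 0) \<noteq> t"
        hence "norm (y + w - x) + norm w \<noteq> t" by (simp add: algebra_simps)
        hence "isCont (trunc_power j t) (norm (y + w - x) + norm w)" by (rule isCont_trunc_power)
        moreover have "(\<lambda>n. norm (u n + w - x) + norm w) \<longlonglongrightarrow> norm (y + w - x) + norm w"
          by (intro tendsto_intros u)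
        ultimately have "(\<lambda>n. trunc_power j t (norm (u n + w - x)
          + norm w)) \<longlonglongrightarrow> trunc_power j t (norm (y + w - x) + norm w)"
          by (rule isCont_tendsto_compose)
        moreover have "(\<lambda>n. g (u n + w)) \<longlonglongrightarrow> g (y + w)"
          using g by (intro isCont_tendsto_compose[where g = g])
            (auto intro!: tendsto_intros u simp: continuous_on_eq_continuous_at)
        ultimately show "(\<lambda>n. ?G (u n) w) \<longlonglongrightarrow> ?G y w" by (intro tendsto_intros)
      qed
      show "AE w in lborel. norm (?G (u n) w) \<le> ?D w" for n
      proof (rule AE_I2)
        fix w
        show "norm (?G (u n) w) \<le> ?D w"
        proof (cases "u n + w \<in> S")
          case True
          have "norm w \<le> norm (u n + w) + norm (u n)" using norm_triangle_ineq4[of "u n + w" "u n"] by simp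
          hence "w \<in> cball 0 (Y + RS)" using RS[OF True] Y[of n] by simp
          moreover have "norm (?G (u n) w) \<le> \<bar>t\<bar> ^ j * (M * (1 + 1 / (norm w)\<^sup>2))"
            unfolding norm_mult
          proof (intro mult_mono)
            show "norm (trunc_power j t (norm (u n + w - x) + norm w)) \<le> \<bar>t\<bar> ^ j"
              using trunc_power_bound[of "norm (u n + w - x) + norm w" j t] by simp
            have "norm (g (u n + w) \<bullet> \<kappa> w) \<le> norm (g (u n + w)) * norm (\<kappa> w)"
              by (simp add: Cauchy_Schwarz_ineq2)
            also have "\<dots> \<le> M * (1 + 1 / (norm w)\<^sup>2)" by (intro mult_mono M kb) auto
            finally show "norm (g (u n + w) \<bullet> \<kappa> w) \<le> M * (1 + 1 / (norm w)\<^sup>2)" .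
          qed auto
          ultimately show ?thesis by (simp add: algebra_simps)
        next
          case False
          thus ?thesis using M by (auto simp: out)
        qed
      qed
    qed measurable
  qed
  thus ?thesis
    unfolding eq continuous_on_sequentially by (auto simp: comp_def)
qed

section \<open>The kernel and the reconstruction\<close>

text \<open>The parts of the densities in the kernel that do not involve \<open>y\<close>; the factor \<open>1 / norm (z - x)\<close> is
harmless because \<open>x\<close> lies outside the supports.\<close>

definition weight_\<alpha> :: "real \<Rightarrow> (real^3 \<Rightarrow> real) \<Rightarrow> real^3 \<Rightarrow> real^3 \<Rightarrow> real" where
  "weight_\<alpha> \<epsilon> \<alpha> x z = \<epsilon> * \<alpha> z / (16 * pi\<^sup>2 * norm (z - x))"

definition weight_\<rho> :: "real \<Rightarrow> (real^3 \<Rightarrow> real) \<Rightarrow> real^3 \<Rightarrow> real^3 \<Rightarrow> real^3" where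
  "weight_\<rho> \<epsilon> \<rho> x z = (\<epsilon> / (16 * pi\<^sup>2 * norm (z - x))) *\<^sub>R gradient \<rho> z"

lemma kernel_eq:
  "kernel \<epsilon> \<alpha> \<rho> t x y =
     (max 0 (t - norm (y - x)))\<^sup>2 / (8 * pi * norm (y - x)) * (1 - \<epsilon> * \<alpha> y)
     + ell_int 0 t x y (\<lambda>z. weight_\<alpha> \<epsilon> \<alpha> x z \<bullet> (1 / norm (z - y)))
     + ell_int 1 t x y (\<lambda>z. weight_\<rho> \<epsilon> \<rho> x z \<bullet> ((z - y) /\<^sub>R (norm (z - y))\<^sup>2))
     + ell_int 2 t x y (\<lambda>z. weight_\<rho> \<epsilon> \<rho> x z \<bullet> ((z - y) /\<^sub>R (norm (z - y)) ^ 3)) / 2"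
proof (cases "t < norm (y - x)")
  case True
  have "trunc_power j t (norm (z - x) + norm (z - y)) = 0" for j z
    using True norm_triangle_ineq4[of "z - x" "z - y"] by (simp add: trunc_power_def)
  thus ?thesis using True by (simp add: kernel_def ell_int_def)
next
  case False
  have 0: "(LINT z:ellipsoid t x y|lborel.
           1 / (16 * pi\<^sup>2 * norm (z - x) * norm (z - y)) * (\<epsilon> * \<alpha> z))
      = ell_int 0 t x y (\<lambda>z. weight_\<alpha> \<epsilon> \<alpha> x z \<bullet> (1 / norm (z - y)))"
    unfolding set_lebesgue_integral_def ell_int_def
    by (rule Bochner_Integration.integral_cong)
       (auto simp: ellipsoid_def trunc_power_def weight_\<alpha>_def indicator_def)
  have 1: "(LINT z:ellipsoid t x y|lborel.
           (t - norm (z - x) - norm (z - y)) / (16 * pi\<^sup>2 * norm (z - x) * norm (z - y))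
           * ((\<epsilon> *\<^sub>R gradient \<rho> z) \<bullet> ((z - y) /\<^sub>R norm (z - y))))
      = ell_int 1 t x y (\<lambda>z. weight_\<rho> \<epsilon> \<rho> x z \<bullet> ((z - y) /\<^sub>R (norm (z - y))\<^sup>2))"
    unfolding set_lebesgue_integral_def ell_int_def
    by (rule Bochner_Integration.integral_cong)
       (auto simp: ellipsoid_def trunc_power_def weight_\<rho>_def indicator_def power2_eq_square diff_diff_eq
         inverse_eq_divide mult_ac)
  have 2: "(LINT z:ellipsoid t x y|lborel.
           (t - norm (z - x) - norm (z - y))\<^sup>2 / (32 * pi\<^sup>2 * norm (z - x) * (norm (z - y))\<^sup>2)
           * ((\<epsilon> *\<^sub>R gradient \<rho> z) \<bullet> ((z - y) /\<^sub>R norm (z - y))))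
      = ell_int 2 t x y (\<lambda>z. weight_\<rho> \<epsilon> \<rho> x z \<bullet> ((z - y) /\<^sub>R (norm (z - y)) ^ 3)) / 2"
    unfolding set_lebesgue_integral_def ell_int_def integral_divide_zero[symmetric]
    by (rule Bochner_Integration.integral_cong)
       (auto simp: ellipsoid_def trunc_power_def weight_\<rho>_def indicator_def power2_eq_square
         power3_eq_cube diff_diff_eq
         inverse_eq_divide mult_ac)
  show ?thesis
    using False unfolding kernel_def 0 1 2 by (simp add: max_def)
qed

text \<open>The kernel is continuous also at points \<open>y\<close> in the supports of \<open>\<alpha>\<close> and \<open>\<rho>\<close>,
where the densities are singular.\<close>

lemma kernel_continuous:
  assumes a: "C_k_c 0 \<alpha>" and r: "C_k_c 1 \<rho>" and xa: "x \<notin> supp \<alpha>" and xr: "x \<notin> supp \<rho>" and y: "y \<noteq> x"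
  shows "isCont (kernel \<epsilon> \<alpha> \<rho> t x) y"
proof -
  have ac: "continuous_on UNIV \<alpha>" "compact (supp \<alpha>)" using a by (auto simp: C_k_c_0_iff)
  have rc: "C_k (Suc 0) \<rho>" "compact (supp \<rho>)" using r by (auto simp: C_k_c_def)
  have wa: "continuous_on UNIV (weight_\<alpha> \<epsilon> \<alpha> x)"
  proof -
    have "continuous_on UNIV (\<lambda>z. (\<epsilon> / (16 * pi\<^sup>2 * norm (z - x))) *\<^sub>R \<alpha> z)"
      by (rule continuous_scaleR_off_supp[OF ac(1) closed_supp])
         (use xa in \<open>auto simp: not_in_supp intro!: continuous_intros\<close>)
    thus ?thesis by (simp add: weight_\<alpha>_def[abs_def])
  qed
  have wr: "continuous_on UNIV (weight_\<rho> \<epsilon> \<rho> x)"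
    unfolding weight_\<rho>_def[abs_def]
    by (rule continuous_scaleR_off_supp[OF C_1_D(2)[OF rc(1)] closed_supp[of \<rho>]])
       (use xr in \<open>auto simp: gradient_not_in_supp intro!: continuous_intros\<close>)
  have inv_le: "1 / b \<le> 1 + 1 / b\<^sup>2" if "b \<ge> 0" for b :: real
  proof (cases "b = 0")
    case False
    have "0 \<le> (1 / b - 1)\<^sup>2" by simp
    also have "\<dots> = 1 / b\<^sup>2 - 2 * (1 / b) + 1" by (simp add: power2_diff power_divide)
    finally show ?thesis using that by (smt (verit) divide_nonneg_nonneg)
  qed simp
  have n1: "norm (w /\<^sub>R (norm w)\<^sup>2) = 1 / norm w" for w :: "real^3"
    by (cases "w = 0") (auto simp: power2_eq_square field_simps)
  have n2: "norm (w /\<^sub>R norm w ^ 3) = 1 / (norm w)\<^sup>2" for w :: "real^3"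
    by (cases "w = 0") (auto simp: power2_eq_square power3_eq_cube field_simps)
  have c0: "continuous_on UNIV (\<lambda>y. ell_int 0 t x y (\<lambda>z. weight_\<alpha> \<epsilon> \<alpha> x z \<bullet> (1 / norm (z - y))))"
    by (rule continuous_ell_int[OF wa ac(2), of "\<lambda>w. 1 / norm w"])
       (auto simp: not_in_supp weight_\<alpha>_def inv_le)
  have c1: "continuous_on UNIV (\<lambda>y. ell_int 1 t x y (\<lambda>z. weight_\<rho> \<epsilon> \<rho> x z \<bullet> ((z - y) /\<^sub>R (norm (z - y))\<^sup>2)))"
    by (rule continuous_ell_int[OF wr rc(2), of "\<lambda>w. w /\<^sub>R (norm w)\<^sup>2"])
       (auto simp: gradient_not_in_supp weight_\<rho>_def n1 inv_le simp del: norm_scaleR)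
  have c2: "continuous_on UNIV (\<lambda>y. ell_int 2 t x y (\<lambda>z. weight_\<rho> \<epsilon> \<rho> x z \<bullet> ((z - y) /\<^sub>R (norm (z - y)) ^ 3)))"
    by (rule continuous_ell_int[OF wr rc(2), of "\<lambda>w. w /\<^sub>R (norm w) ^ 3"])
       (auto simp: gradient_not_in_supp weight_\<rho>_def n2 simp del: norm_scaleR)
  have at: "isCont f y" if "continuous_on UNIV f" for f :: "real^3 \<Rightarrow> real"
    using that by (auto simp: continuous_on_eq_continuous_at)
  show ?thesis
    unfolding kernel_eq[abs_def]
    by (intro continuous_intros at[OF c0] at[OF c1] at[OF c2] at[OF ac(1)]) (use y in auto)
qed

lemma kernel_eq_0: "t \<le> norm (y - x) \<Longrightarrow> kernel \<epsilon> \<alpha> \<rho> t x y = 0"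
  by (simp add: kernel_eq ell_int_eq_0)

lemma radon_inv_measurement:
  assumes f: "C_k_c 0 f" and a: "C_k_c 0 \<alpha>" and r: "C_k_c 1 \<rho>"
    and x: "x \<notin> supp f" "x \<notin> supp \<alpha>" "x \<notin> supp \<rho>"
  shows "radon_inv (measurement \<epsilon> f \<alpha> \<rho> t x) = (\<lambda>y. kernel \<epsilon> \<alpha> \<rho> t x y * f y)"
proof (rule radon_inv_eqI)
  have fc: "continuous_on UNIV f" "compact (supp f)" using f by (auto simp: C_k_c_0_iff)
  show "C_k_c 0 (\<lambda>y. kernel \<epsilon> \<alpha> \<rho> t x y * f y)"
    unfolding C_k_c_0_iff
  proof
    have "continuous_on UNIV (\<lambda>y. kernel \<epsilon> \<alpha> \<rho> t x y *\<^sub>R f y)"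
      by (rule continuous_scaleR_off_supp[OF fc(1) closed_supp])
         (use x in \<open>auto simp: not_in_supp intro!: kernel_continuous[OF a r]\<close>)
    thus "continuous_on UNIV (\<lambda>y. kernel \<epsilon> \<alpha> \<rho> t x y * f y)" by simp
    show "compact (supp (\<lambda>y. kernel \<epsilon> \<alpha> \<rho> t x y * f y))"
      by (rule compact_suppI[OF _ fc(2)]) (auto, metis not_in_supp)
  qed
  fix r \<theta>
  show "radon (\<lambda>y. kernel \<epsilon> \<alpha> \<rho> t x y * f y) r \<theta> = measurement \<epsilon> f \<alpha> \<rho> t x r \<theta>"
    unfolding radon_def measurement_def set_lebesgue_integral_def
    by (rule Bochner_Integration.integral_cong)
       (auto simp: indicator_def dist_norm norm_minus_commute kernel_eq_0)
qed

lemma continuous_over_norm_power: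
  fixes g :: "real^3 \<Rightarrow> real"
  assumes g: "continuous_on UNIV g" and S: "closed S" and out: "\<And>z. z \<notin> S \<Longrightarrow> g z = 0" and y: "y \<notin> S"
  shows "continuous_on UNIV (\<lambda>z. g z / norm (z - y) ^ n)"
proof -
  have "continuous_on UNIV (\<lambda>z. (1 / norm (z - y) ^ n) *\<^sub>R g z)"
    by (rule continuous_scaleR_off_supp[OF g S out]) (use y in \<open>auto intro!: continuous_intros\<close>)
  thus ?thesis by simp
qed

lemma weight_\<rho>_inner:
  "weight_\<rho> \<epsilon> \<rho> x z \<bullet> ((z - y) /\<^sub>R norm (z - y) ^ n)
    = \<epsilon> / (16 * pi\<^sup>2) * ((gradient \<rho> z \<bullet> (z - y)) / norm (z - x) ^ 1 / norm (z - y) ^ n)"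
  by (simp add: weight_\<rho>_def inverse_eq_divide mult_ac)

lemma continuous_density_\<rho>:
  assumes r: "C_k_c 1 \<rho>" and x: "x \<notin> supp \<rho>" and y: "y \<notin> supp \<rho>"
  shows "continuous_on UNIV (\<lambda>z. weight_\<rho> \<epsilon> \<rho> x z \<bullet> ((z - y) /\<^sub>R norm (z - y) ^ n))"
proof -
  have rc: "C_k (Suc 0) \<rho>" using r by (auto simp: C_k_c_def)
  show ?thesis
    unfolding weight_\<rho>_inner
    by (intro continuous_on_mult continuous_on_const continuous_over_norm_power[OF _ closed_supp[of \<rho>]]
          continuous_intros C_1_D(2)[OF rc])
       (use x y in \<open>auto simp: gradient_not_in_supp\<close>)
qed

lemma deriv_eqI_open:
  assumes "open S" "t \<in> S" "\<And>s. s \<in> S \<Longrightarrow> g s = h s" "(h has_real_derivative D) (at t)"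
  shows "deriv g t = D"
  by (rule DERIV_imp_deriv, rule has_field_derivative_transform_within_open[OF assms(4,1,2)])
     (simp add: assms(3))

section \<open>Large times\<close>

text \<open>The field \<open>(z - y) / norm (z - y) ^ 3\<close> is divergence free off \<open>y\<close>. The identity follows without
the divergence theorem by differentiating a dilation-invariant integral.\<close>

lemma radial_flux_eq_0:
  assumes r: "C_k_c 1 \<rho>" and y: "y \<notin> supp \<rho>"
  shows "(\<integral>z. gradient \<rho> z \<bullet> (z - y) / norm (z - y) ^ 3 \<partial>lborel) = 0"
proof -
  have rc: "C_k (Suc 0) \<rho>" and comp: "compact (supp \<rho>)" using r by (auto simp: C_k_c_def)
  have gd: "GDERIV \<rho> z :> gradient \<rho> z" and gc: "continuous_on UNIV (gradient \<rho>)"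
    and cont: "continuous_on UNIV \<rho>" for z using C_1_D[OF rc] by auto
  have [measurable]: "gradient \<rho> \<in> borel_measurable borel" "\<rho> \<in> borel_measurable borel"
    using gc cont by (auto intro: borel_measurable_continuous_onI)
  obtain M where M: "0 \<le> M" "\<And>z. norm (gradient \<rho> z) \<le> M" "\<And>z w. \<bar>\<rho> z - \<rho> w\<bar> \<le> M * norm (z - w)"
    using C_k_c_1_Lipschitz[OF r] by blast
  obtain A where A: "0 \<le> A" "\<And>z. norm (\<rho> z) \<le> A"
    using continuous_supp_bounded[OF cont comp] not_in_supp by metis
  obtain R0 where R0: "\<And>z. z \<in> supp \<rho> \<Longrightarrow> norm z \<le> R0"
    using comp compact_imp_bounded bounded_iff by metis
  define R where "R = \<bar>R0\<bar> + norm y"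
  have R: "norm u \<le> R" if "y + u \<in> supp \<rho>" for u
    using R0[OF that] norm_triangle_ineq4[of "y + u" y] by (simp add: R_def)
  have "open (- supp \<rho>)" using closed_supp by auto
  then obtain \<delta> where \<delta>: "\<delta> > 0" "ball y \<delta> \<subseteq> - supp \<rho>"
    using y open_contains_ball by (metis ComplI)
  have dlt: "\<delta> \<le> norm u" if "y + u \<in> supp \<rho>" for u
    using \<delta>(2) that by (force simp: dist_norm)
  let ?\<psi> = "\<lambda>l. \<integral>u. \<rho> (y + l *\<^sub>R u) / norm u ^ 3 \<partial>lborel"
  \<comment> \<open>The measure \<open>du / norm u ^ 3\<close> is invariant under dilations.\<close>
  have const: "?\<psi> l = ?\<psi> 1" if l: "l > 0" for l
  proof -
    have "?\<psi> 1 = (\<integral>u. \<rho> (y + u) / norm u ^ 3 \<partial>lborel)" by simp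
    also have "\<dots> = \<bar>l\<bar> ^ DIM(real^3) * (\<integral>w. \<rho> (y + (0 + l *\<^sub>R w)) / norm (0 + l *\<^sub>R w) ^ 3 \<partial>lborel)"
      by (rule integral_affine) (use l in auto)
    also have "\<dots> = ?\<psi> l"
      using l by (simp add: power_mult_distrib integral_divide_zero flip: integral_mult_right_zero)
    finally show ?thesis by simp
  qed
  have deriv: "(?\<psi> has_real_derivative (\<integral>u. gradient \<rho> (y + u) \<bullet> u / norm u ^ 3 \<partial>lborel)) (at 1)"
  proof -
    let ?C = "\<lambda>u::real^3. (M * (2 * R) / (\<delta> / 2) ^ 3) * indicator (cball 0 (2 * R)) u"
    have sup: "norm u \<le> 2 * R \<and> \<delta> / 2 \<le> norm u" if l: "\<bar>l - 1\<bar> < 1 / 2" and u: "y + l *\<^sub>R u \<in> supp \<rho>" for l u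
    proof -
      have l': "1/2 \<le> l" "l \<le> 2" using l by linarith+
      have "(1/2) * norm u \<le> l * norm u" "l * norm u \<le> 2 * norm u" using l' by (intro mult_right_mono; simp)+
      thus ?thesis using R[OF u] dlt[OF u] l' by simp
    qed
    have int: "integrable lborel (\<lambda>u. \<rho> (y + l *\<^sub>R u) / norm u ^ 3)" if l: "\<bar>l - 1\<bar> < 1 / 2" for l
    proof (rule integrable_bounded_support[where M = "A / (\<delta> / 2) ^ 3" and S = "cball 0 (2 * R)"])
      fix u
      show "\<bar>\<rho> (y + l *\<^sub>R u) / norm u ^ 3\<bar> \<le> A / (\<delta> / 2) ^ 3"
      proof (cases "y + l *\<^sub>R u \<in> supp \<rho>")
        case True
        hence "(\<delta> / 2) ^ 3 \<le> norm u ^ 3" using sup[OF l] \<delta> by (intro power_mono) auto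
        thus ?thesis using A(2)[of "y + l *\<^sub>R u"] A(1) \<delta> by (auto simp: abs_divide intro!: frac_le)
      qed (use A \<delta> in \<open>auto simp: not_in_supp\<close>)
      show "u \<notin> cball 0 (2 * R) \<Longrightarrow> \<rho> (y + l *\<^sub>R u) / norm u ^ 3 = 0"
        using sup[OF l, of u] not_in_supp[of "y + l *\<^sub>R u" \<rho>] by auto
    qed auto
    have lip: "\<bar>\<rho> (y + l *\<^sub>R u) / norm u ^ 3 - \<rho> (y + 1 *\<^sub>R u) / norm u ^ 3\<bar>
        \<le> M * (2 * R) / (\<delta> / 2) ^ 3 * indicator (cball 0 (2 * R)) u * \<bar>l - 1\<bar>"
      if l: "\<bar>l - 1\<bar> < 1 / 2" for l u
    proof (cases "y + l *\<^sub>R u \<in> supp \<rho> \<or> y + 1 *\<^sub>R u \<in> supp \<rho>")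
      case True
      hence u: "norm u \<le> 2 * R" "\<delta> / 2 \<le> norm u" using sup[OF l, of u] sup[of 1 u] by auto
      have "\<bar>\<rho> (y + l *\<^sub>R u) - \<rho> (y + 1 *\<^sub>R u)\<bar> \<le> M * norm ((y + l *\<^sub>R u) - (y + 1 *\<^sub>R u))"
        by (rule M(3))
      also have "(y + l *\<^sub>R u) - (y + 1 *\<^sub>R u) = (l - 1) *\<^sub>R u" by (simp add: algebra_simps)
      also have "M * norm ((l - 1) *\<^sub>R u) \<le> M * (2 * R) * \<bar>l - 1\<bar>"
        using u M mult_left_mono[of "norm u" "2 * R" "M * \<bar>l - 1\<bar>"] by (simp add: mult_ac)
      finally have "\<bar>\<rho> (y + l *\<^sub>R u) - \<rho> (y + 1 *\<^sub>R u)\<bar> / norm u ^ 3 \<le> M * (2 * R) * \<bar>l - 1\<bar> / (\<delta> / 2) ^ 3"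
        using u \<delta> M order_trans[OF norm_ge_zero u(1)] by (intro frac_le power_mono) auto
      moreover have "\<rho> (y + l *\<^sub>R u) / norm u ^ 3 - \<rho> (y + 1 *\<^sub>R u) / norm u ^ 3
          = (\<rho> (y + l *\<^sub>R u) - \<rho> (y + 1 *\<^sub>R u)) / norm u ^ 3"
        by (simp only: diff_divide_distrib)
      ultimately show ?thesis using u(1) by (simp only: abs_divide) (simp add: mult_ac)
    next
      case False
      hence z: "\<rho> (y + l *\<^sub>R u) = 0" "\<rho> (y + 1 *\<^sub>R u) = 0" by (auto simp: not_in_supp)
      show ?thesis
      proof (cases "norm u \<le> 2 * R")
        case True
        hence "0 \<le> R" using order_trans[OF norm_ge_zero True] by simp
        thus ?thesis unfolding z using M \<delta> by (auto simp: indicator_def)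
      qed (unfold z, simp)
    qed
    have der: "AE u in lborel. ((\<lambda>l. \<rho> (y + l *\<^sub>R u) / norm u ^ 3) has_real_derivative
        gradient \<rho> (y + u) \<bullet> u / norm u ^ 3) (at 1)"
    proof (rule AE_I2)
      fix u
      have "((\<lambda>l. y + l *\<^sub>R u) has_derivative (\<lambda>h. h *\<^sub>R u)) (at 1)"
        by (auto intro!: derivative_eq_intros)
      moreover have "(\<rho> has_derivative (\<lambda>h. h \<bullet> gradient \<rho> (y + 1 *\<^sub>R u))) (at (y + 1 *\<^sub>R u))"
        using gd by (simp add: gderiv_def)
      ultimately have "((\<lambda>l. \<rho> (y + l *\<^sub>R u)) has_derivative (\<lambda>h. (h *\<^sub>R u) \<bullet> gradient \<rho> (y + 1 *\<^sub>R u))) (at 1)"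
        by (rule has_derivative_compose)
      hence "((\<lambda>l. \<rho> (y + l *\<^sub>R u)) has_real_derivative (gradient \<rho> (y + u) \<bullet> u)) (at 1)"
        by (simp add: has_field_derivative_def inner_commute mult_commute_abs)
      thus "((\<lambda>l. \<rho> (y + l *\<^sub>R u) / norm u ^ 3) has_real_derivative
        gradient \<rho> (y + u) \<bullet> u / norm u ^ 3) (at 1)" by (rule DERIV_cdivide)
    qed
    have [measurable]: "cball (0::real^3) (2 * R) \<in> sets borel" by simp
    have Ci: "integrable lborel (\<lambda>u::real^3. M * (2 * R) / (\<delta> / 2) ^ 3 * indicator (cball 0 (2 * R)) u)"
      by (intro integrable_mult_right integrable_real_indicator) 
         (auto simp: emeasure_lborel_cball_finite[unfolded infinity_ennreal_def])
    have meas: "(\<lambda>u. gradient \<rho> (y + u) \<bullet> u / norm u ^ 3) \<in> borel_measurable lborel"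
      by measurable
    have half: "(0::real) < 1 / 2" by simp
    show ?thesis
      by (rule has_real_derivative_integral[of "1/2" 1 lborel "\<lambda>l u. \<rho> (y + l
        *\<^sub>R u) / norm u ^ 3" _ ?C, OF half int der lip Ci meas])
  qed
  have "((\<lambda>_. ?\<psi> 1) has_real_derivative 0) (at 1)" by simp
  hence "(?\<psi> has_real_derivative 0) (at 1)"
    by (rule has_field_derivative_transform_within_open[of _ _ _ "{0<..}"]) (use const in auto)
  hence "(\<integral>u. gradient \<rho> (y + u) \<bullet> u / norm u ^ 3 \<partial>lborel) = 0"
    using deriv DERIV_unique by blast
  moreover have "(\<integral>z. gradient \<rho> z \<bullet> (z - y) / norm (z - y) ^ 3 \<partial>lborel)
      = (\<integral>u. gradient \<rho> (y + u) \<bullet> (y + u - y) / norm (y + u - y) ^ 3 \<partial>lborel)"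
    by (rule integral_translate) measurable
  ultimately show ?thesis by simp
qed

text \<open>The limit at large times determines the source outside the supports of the coefficients.\<close>

lemma data_Ninf_eq:
  assumes f: "C_k_c 0 f" and a: "C_k_c 0 \<alpha>" and r: "C_k_c 1 \<rho>"
    and x: "x \<notin> supp f" "x \<notin> supp \<alpha>" "x \<notin> supp \<rho>"
    and y: "y \<notin> supp \<alpha>" "y \<notin> supp \<rho>" "y \<noteq> x"
  shows "data_Ninf \<epsilon> f \<alpha> \<rho> x y = f y / (4 * pi)"
proof -
  let ?s = "\<lambda>z. norm (z - x) + norm (z - y)"
  let ?A = "\<lambda>z. weight_\<alpha> \<epsilon> \<alpha> x z \<bullet> (1 / norm (z - y))"
  let ?B = "\<lambda>z. weight_\<rho> \<epsilon> \<rho> x z \<bullet> ((z - y) /\<^sub>R (norm (z - y))\<^sup>2)"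
  let ?C = "\<lambda>z. weight_\<rho> \<epsilon> \<rho> x z \<bullet> ((z - y) /\<^sub>R norm (z - y) ^ 3)"
  define d where "d = norm (y - x)"
  have d: "d > 0" using y by (simp add: d_def)
  have ca: "compact (supp \<alpha>)" and cr: "compact (supp \<rho>)" using a r by (auto simp: C_k_c_def)
  obtain Ra where Ra: "\<And>z. z \<in> supp \<alpha> \<Longrightarrow> norm z \<le> Ra" using ca compact_imp_bounded bounded_iff by metis
  obtain Rr where Rr: "\<And>z. z \<in> supp \<rho> \<Longrightarrow> norm z \<le> Rr" using cr compact_imp_bounded bounded_iff by metis
  define R where "R = max 0 (max Ra Rr)"
  have R: "z \<in> supp \<alpha> \<Longrightarrow> norm z \<le> R" "z \<in> supp \<rho> \<Longrightarrow> norm z \<le> R" for z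
    using Ra[of z] Rr[of z] by (auto simp: R_def)
  define T where "T = 2 * R + norm x + norm y"
  have dT: "d \<le> T" using norm_triangle_ineq4[of y x] by (simp add: d_def T_def R_def)
  have A0: "?A z = 0" if "z \<notin> supp \<alpha>" for z using that by (simp add: weight_\<alpha>_def not_in_supp)
  have W0: "weight_\<rho> \<epsilon> \<rho> x z \<bullet> w = 0" if "z \<notin> supp \<rho>" for z w using that by
    (simp add: weight_\<rho>_def gradient_not_in_supp)
  have cB: "continuous_on UNIV ?B" and cC: "continuous_on UNIV ?C"
    by (rule continuous_density_\<rho>[OF r x(3) y(2)])+
  have int: "integrable lborel (\<lambda>z. h z * ?B z)" "integrable lborel (\<lambda>z. h z * ?C z)"
    if "continuous_on UNIV h" for h
    by (rule integrable_continuous_compact[OF continuous_on_mult[OF that cB] cr],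
        simp only: W0 mult_zero_right not_False_eq_True)
       (rule integrable_continuous_compact[OF continuous_on_mult[OF that cC] cr],
        simp only: W0 mult_zero_right not_False_eq_True)
  define b0 b1 c0 c1 c2 where "b0 = (\<integral>z. ?B z \<partial>lborel)" and "b1 = (\<integral>z. ?s z * ?B z \<partial>lborel)"
    and "c0 = (\<integral>z. ?C z \<partial>lborel)" and "c1 = (\<integral>z. ?s z * ?C z \<partial>lborel)"
    and "c2 = (\<integral>z. (?s z)\<^sup>2 * ?C z \<partial>lborel)"
  define a0 where "a0 = (\<integral>z. ?A z \<partial>lborel)"
  have sc: "continuous_on UNIV ?s" by (intro continuous_intros)
  let ?g = "\<lambda>t. radon_inv (measurement \<epsilon> f \<alpha> \<rho> t x) y"
  define p where "p = (\<lambda>t. ((t - d)\<^sup>2 / (8 * pi * d) + a0 + (t * b0 - b1) + (t\<^sup>2 * c0 - 2 * t * c1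
    + c2) / 2) * f y)"
  define p' where "p' = (\<lambda>t. ((t - d) / (4 * pi * d) + b0 + (t * c0 - c1)) * f y)"
  \<comment> \<open>For \<open>t > T\<close> the ellipsoid contains both supports, so the reconstruction is quadratic in \<open>t\<close>.\<close>
  have g_eq: "?g t = p t" if t: "t > T" for t
  proof -
    have td: "t > d" and TR: "2 * R + norm x + norm y \<le> t"
      using t dT by (auto simp: T_def)
    have RA: "norm z \<le> R" if "?A z \<noteq> 0" for z using that A0 R(1) by blast
    have RW: "norm z \<le> R" if "weight_\<rho> \<epsilon> \<rho> x z \<bullet> w \<noteq> 0" for z w using that W0 R(2) by blast
    have "ell_int 0 t x y ?A = a0"
      by (subst ell_int_large[OF RA TR]) (simp_all add: a0_def)
    moreover have "ell_int 1 t x y ?B = t * b0 - b1"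
    proof -
      have "ell_int 1 t x y ?B = (\<integral>z. (t - ?s z) ^ 1 * ?B z \<partial>lborel)"
        by (rule ell_int_large[OF RW TR])
      also have "\<dots> = (\<integral>z. t * ?B z - ?s z * ?B z \<partial>lborel)"
        by (simp only: power_one_right left_diff_distrib)
      also have "\<dots> = t * b0 - b1"
        using int(1)[OF sc] int(1)[of "\<lambda>_. t"] int(1)[of "\<lambda>_. 1"] by (simp add: b0_def b1_def)
      finally show ?thesis .
    qed
    moreover have "ell_int 2 t x y ?C = t\<^sup>2 * c0 - 2 * t * c1 + c2"
    proof -
      have sq: "(t - s)\<^sup>2 * c = t\<^sup>2 * c - 2 * t * (s * c) + s\<^sup>2 * c" for s c :: real
        by (simp add: power2_eq_square algebra_simps)
      have "ell_int 2 t x y ?C = (\<integral>z. (t - ?s z)\<^sup>2 * ?C z \<partial>lborel)"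
        by (rule ell_int_large[OF RW TR])
      also have "\<dots> = (\<integral>z. t\<^sup>2 * ?C z - 2 * t * (?s z * ?C z) + (?s z)\<^sup>2 * ?C z \<partial>lborel)"
        by (simp only: sq)
      also have "\<dots> = t\<^sup>2 * c0 - 2 * t * c1 + c2"
        using int(2)[OF sc] int(2)[of "\<lambda>_. 1"] int(2)[OF continuous_on_power[OF sc]]
        by (simp add: c0_def c1_def c2_def)
      finally show ?thesis .
    qed
    ultimately show ?thesis
      using td by (simp add: radon_inv_measurement[OF f a r x] kernel_eq not_in_supp[OF y(1)] p_def d_def)
  qed
  have dp: "(p has_real_derivative p' t) (at t)" for t
    unfolding p_def p'_def using d by (auto intro!: derivative_eq_intros simp: field_simps)
  have dp': "(p' has_real_derivative (1 / (4 * pi * d) + c0) * f y) (at t)" for t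
    unfolding p'_def using d by (auto intro!: derivative_eq_intros simp: field_simps)
  have dg: "deriv ?g t = p' t" if "t > T" for t
    by (rule deriv_eqI_open[of "{T<..}" _ _ p]) (use that g_eq dp in auto)
  have ddg: "deriv (deriv ?g) t = (1 / (4 * pi * d) + c0) * f y" if "t > T" for t
    by (rule deriv_eqI_open[of "{T<..}" _ _ p']) (use that dg dp' in auto)
  have M: "data_Minf \<epsilon> f \<alpha> \<rho> x y = (1 / (4 * pi * d) + c0) * f y"
    unfolding data_Minf_def
    by (rule tendsto_Lim[OF _ tendsto_eventually]) (use ddg in \<open>auto intro: eventually_mono[OF
      eventually_gt_at_top[of T]]\<close>)
  have "data_Ninf \<epsilon> f \<alpha> \<rho> x y = (1 / (4 * pi) + (c1 - b0)) * f y"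
    unfolding data_Ninf_def
  proof (rule tendsto_Lim[OF _ tendsto_eventually])
    show "\<forall>\<^sub>F t in at_top. data_Minf \<epsilon> f \<alpha> \<rho> x y * t - deriv ?g t = (1 / (4 * pi) + (c1 - b0)) * f y"
      using eventually_gt_at_top[of T]
    proof eventually_elim
      fix t assume "t > T"
      thus "data_Minf \<epsilon> f \<alpha> \<rho> x y * t - deriv ?g t = (1 / (4 * pi) + (c1 - b0)) * f y"
        using d by (simp add: M dg p'_def field_simps)
    qed
  qed simp
  also have "c1 - b0 = (\<integral>z. ?s z * ?C z - ?B z \<partial>lborel)"
    using int(2)[OF sc] int(1)[of "\<lambda>_. 1"] by (simp add: c1_def b0_def)
  also have "\<dots> = (\<integral>z. \<epsilon> / (16 * pi\<^sup>2) * (gradient \<rho> z \<bullet> (z - y) / norm (z - y) ^ 3) \<partial>lborel)"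
  proof (rule Bochner_Integration.integral_cong)
    fix z
    show "?s z * ?C z - ?B z = \<epsilon> / (16 * pi\<^sup>2) * (gradient \<rho> z \<bullet> (z - y) / norm (z - y) ^ 3)"
    proof (cases "z \<in> supp \<rho>")
      case True
      hence "norm (z - x) \<noteq> 0" "norm (z - y) \<noteq> 0" using x y by auto
      thus ?thesis unfolding weight_\<rho>_inner by (simp add: field_simps power2_eq_square power3_eq_cube)
    qed (simp add: weight_\<rho>_def gradient_not_in_supp)
  qed simp
  also have "\<dots> = 0"
    by (simp only: integral_mult_right_zero radial_flux_eq_0[OF r y(2)] mult_zero_right)
  finally show ?thesis by simp
qed

section \<open>Small times\<close>

lemma cball_triple: "(r :: real, p :: real, q :: real) \<in> cball 0 1 \<longleftrightarrow> r\<^sup>2 + (p\<^sup>2 + q\<^sup>2) \<le> 1"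
  by (simp add: norm_Pair)

lemma cball_triple_bounds:
  assumes "(r :: real, p :: real, q :: real) \<in> cball 0 1"
  shows "\<bar>r\<bar> \<le> 1" "\<bar>p\<bar> \<le> 1" "\<bar>q\<bar> \<le> (1::real)"
proof -
  have "r\<^sup>2 + (p\<^sup>2 + q\<^sup>2) \<le> 1" using assms unfolding cball_triple .
  hence "r\<^sup>2 \<le> 1" "p\<^sup>2 \<le> 1" "q\<^sup>2 \<le> 1" using zero_le_power2[of r] zero_le_power2[of p]
    zero_le_power2[of q] by linarith+
  thus "\<bar>r\<bar> \<le> 1" "\<bar>p\<bar> \<le> 1" "\<bar>q\<bar> \<le> (1::real)" by (simp_all add: abs_square_le_1)
qed

text \<open>The slice of the unit ball at height \<open>r\<close> is a disc of area \<open>pi * (1 - r\<^sup>2)\<close>.\<close>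

lemma integral_ball_slices:
  fixes g :: "real \<Rightarrow> real"
  assumes gm [measurable]: "g \<in> borel_measurable borel" and bnd: "\<And>r. \<bar>g r\<bar> \<le> M"
  shows "(\<integral>w. indicator (cball 0 1) w * g (fst w) \<partial>(lborel :: (real \<times> real \<times> real) measure))
       = (\<integral>r. indicator {-1..1} r * (pi * (1 - r\<^sup>2) * g r) \<partial>lborel)"
proof -
  have psf: "pair_sigma_finite (lborel :: real measure) (lborel :: (real \<times> real) measure)" ..
  have [measurable]: "cball (0::real \<times> real \<times> real) 1 \<in> sets borel" by simp
  let ?F = "\<lambda>w :: real \<times> real \<times> real. indicator (cball 0 1) w * g (fst w)"
  have fm: "(\<lambda>w :: real \<times> real \<times> real. g (fst w)) \<in> borel_measurable borel"
    using measurable_compose[OF _ gm] borel_measurable_continuous_onI[OF continuous_on_fst[OF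
      continuous_on_id]] by blast
  have "integrable lborel ?F"
  proof (rule integrable_bounded_support[where M = M and S = "cball 0 1"])
    show "\<bar>?F w\<bar> \<le> M" for w using bnd[of "fst w"] by (auto simp: indicator_def)
    show "?F \<in> borel_measurable borel" using fm by measurable
  qed (auto simp: indicator_def)
  hence "integral\<^sup>L lborel ?F = (\<integral>r. (\<integral>w. ?F (r, w) \<partial>lborel) \<partial>lborel)"
    by (subst pair_sigma_finite.integral_fst'[OF psf]) (simp_all add: lborel_prod)
  also have "(\<lambda>r. \<integral>w. ?F (r, w) \<partial>lborel) = (\<lambda>r. indicator {-1..1} r * (pi * (1 - r\<^sup>2) * g r))"
  proof
    fix r
    show "(\<integral>w. ?F (r, w) \<partial>lborel) = indicator {-1..1} r * (pi * (1 - r\<^sup>2) * g r)"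
    proof (cases "\<bar>r\<bar> \<le> 1")
      case True
      hence r: "r\<^sup>2 \<le> 1" by (simp add: abs_square_le_1)
      have "(\<lambda>w. ?F (r, w)) = (\<lambda>w. g r * indicator (cball 0 (sqrt (1 - r\<^sup>2))) w)"
      proof
        fix w :: "real \<times> real"
        have "(r, w) \<in> cball 0 1 \<longleftrightarrow> w \<in> cball 0 (sqrt (1 - r\<^sup>2))"
          by (cases w) (auto simp: norm_Pair algebra_simps)
        thus "?F (r, w) = g r * indicator (cball 0 (sqrt (1 - r\<^sup>2))) w" by (simp add: indicator_def)
      qed
      hence "(\<integral>w. ?F (r, w) \<partial>lborel)
          = (\<integral>w. g r * indicator (cball (0 :: real \<times> real) (sqrt (1 - r\<^sup>2))) w \<partial>lborel)"
        by (simp only:)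
      also have "\<dots> = g r * measure lborel (cball (0 :: real \<times> real) (sqrt (1 - r\<^sup>2)))"
        by simp
      also have "measure lborel (cball (0 :: real \<times> real) (sqrt (1 - r\<^sup>2))) = pi * (1 - r\<^sup>2)"
        using r by (simp add: content_cball unit_ball_vol_2)
      finally show ?thesis using True by (simp add: indicator_def abs_le_iff)
    next
      case False
      hence "(\<lambda>w. ?F (r, w)) = (\<lambda>w. 0)"
        using cball_triple_bounds(1)[of r] by (auto simp: indicator_def fun_eq_iff)
      hence "(\<integral>w. ?F (r, w) \<partial>lborel) = (\<integral>(w :: real \<times> real). 0 \<partial>lborel)"
        by (simp only:)
      thus ?thesis using False by (auto simp: indicator_def)
    qed
  qed
  finally show ?thesis .
qed

text \<open>In coordinates adapted to the foci, with \<open>A\<close> and \<open>B\<close> the distances to the foci and \<open>d\<close> the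
distance between them, the ellipsoid is the unit ball: \<open>r\<close> is the scaled coordinate along the
axis, \<open>s\<close> the scaled squared distance from it.\<close>

lemma ellipsoid_coordinates:
  fixes A B r s t d :: real
  assumes A: "A \<ge> 0" "A\<^sup>2 = (t / 2 * r + d / 2)\<^sup>2 + (t\<^sup>2 - d\<^sup>2) / 4 * s"
    and B: "B \<ge> 0" "B\<^sup>2 = (t / 2 * r - d / 2)\<^sup>2 + (t\<^sup>2 - d\<^sup>2) / 4 * s"
    and d: "0 \<le> d" "d < t" and s: "0 \<le> s"
  shows "A + B \<le> t \<longleftrightarrow> r\<^sup>2 + s \<le> 1"
proof -
  \<comment> \<open>At height \<open>r\<close>, points of the surface have the distances \<open>(t + d * r) / 2\<close> and \<open>(t - d * r) / 2\<close> to
    the foci. Off the surface both squared distances change by the same \<open>\<eta>\<close>.\<close>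
  define \<eta> where "\<eta> = (t\<^sup>2 - d\<^sup>2) / 4 * (r\<^sup>2 + s - 1)"
  have A2: "A\<^sup>2 = ((t + d * r) / 2)\<^sup>2 + \<eta>"
    unfolding A \<eta>_def by (simp add: power2_eq_square field_simps)
  have B2: "B\<^sup>2 = ((t - d * r) / 2)\<^sup>2 + \<eta>"
    unfolding B \<eta>_def by (simp add: power2_eq_square field_simps)
  have pos: "t\<^sup>2 - d\<^sup>2 > 0" using d by (simp add: power_strict_mono)
  show ?thesis
  proof
    assume le: "r\<^sup>2 + s \<le> 1"
    hence "\<eta> \<le> 0" using pos by (simp add: \<eta>_def mult_nonneg_nonpos)
    have "r\<^sup>2 \<le> 1" using le s by simp
    hence "\<bar>r\<bar> \<le> 1" by (simp add: abs_square_le_1)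
    hence "\<bar>d * r\<bar> \<le> d" using d mult_left_mono[of "\<bar>r\<bar>" 1 d] by (simp add: abs_mult)
    hence nn: "0 \<le> (t + d * r) / 2" "0 \<le> (t - d * r) / 2" using d by auto
    have "A \<le> (t + d * r) / 2"
      by (rule power2_le_imp_le[OF _ nn(1)]) (use A2 \<open>\<eta> \<le> 0\<close> in simp)
    moreover have "B \<le> (t - d * r) / 2"
      by (rule power2_le_imp_le[OF _ nn(2)]) (use B2 \<open>\<eta> \<le> 0\<close> in simp)
    ultimately show "A + B \<le> t" by (simp add: field_simps)
  next
    assume le: "A + B \<le> t"
    show "r\<^sup>2 + s \<le> 1"
    proof (rule ccontr)
      assume "\<not> r\<^sup>2 + s \<le> 1"
      hence "\<eta> > 0" using pos by (simp add: \<eta>_def)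
      have "(t + d * r) / 2 < A"
        by (rule power2_less_imp_less[OF _ A(1)]) (use A2 \<open>\<eta> > 0\<close> in simp)
      moreover have "(t - d * r) / 2 < B"
        by (rule power2_less_imp_less[OF _ B(1)]) (use B2 \<open>\<eta> > 0\<close> in simp)
      ultimately show False using le by (simp add: field_simps)
    qed
  qed
qed

text \<open>The integral over the ellipsoid is differentiable in \<open>t\<close>. In the limit of the degenerate
ellipsoid the derivative becomes a weighted integral over the segment between the foci.\<close>

lemma ell_int_0_derivative:
  assumes a: "C_k_c 1 a" and xy: "y \<noteq> x"
  defines "d \<equiv> norm (y - x)"
  obtains F' where "\<And>t. t > d \<Longrightarrow> ((\<lambda>t. ell_int 0 t x y a) has_real_derivative F' t) (at t)"
    and "(F' \<longlongrightarrow> (\<integral>r. indicator {-1..1} r * (d\<^sup>2 / 4 * pi * (1 - r\<^sup>2)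
            * a ((1/2) *\<^sub>R (x + y) + (r / 2) *\<^sub>R (y - x))) \<partial>lborel)) (at_right d)"
proof -
  have d: "d > 0" using xy by (simp add: d_def)
  have rc: "C_k (Suc 0) a" and comp: "compact (supp a)" using a by (auto simp: C_k_c_def)
  note gd = C_1_D(1)[OF rc] and gc = C_1_D(2)[OF rc] and cont = C_1_D(3)[OF rc]
  have [measurable]: "gradient a \<in> borel_measurable borel" "a \<in> borel_measurable borel"
    using gc cont by (auto intro: borel_measurable_continuous_onI)
  obtain M where M: "0 \<le> M" "\<And>z. norm (gradient a z) \<le> M" "\<And>z w. \<bar>a z - a w\<bar> \<le> M * norm (z - w)"
    using C_k_c_1_Lipschitz[OF a] by blast
  obtain A where A: "0 \<le> A" "\<And>z. \<bar>a z\<bar> \<le> A"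
    using continuous_supp_bounded[OF cont comp] not_in_supp by (metis real_norm_def)
  define e where "e = (y - x) /\<^sub>R d"
  define m where "m = (1/2) *\<^sub>R (x + y)"
  have ne: "norm e = 1" using d by (simp add: e_def d_def)
  define u v where "u = fst (plane_basis e)" and "v = snd (plane_basis e)"
  have on: "orthonormal3 e u v" unfolding u_def v_def by (rule plane_basis_orthonormal[OF ne])
  define \<sigma> where "\<sigma> = (\<lambda>t. sqrt (t\<^sup>2 - d\<^sup>2))"
  have sp: "\<sigma> t > 0" "(\<sigma> t)\<^sup>2 = t\<^sup>2 - d\<^sup>2" if "t > d" for t
    using that d by (auto simp: \<sigma>_def intro!: power_strict_mono)
  \<comment> \<open>For \<open>t > d\<close> the map \<open>Z t\<close> sends the unit ball onto the ellipsoid: its semi-axes are \<open>t / 2\<close>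
    in the direction \<open>e\<close> of the foci and \<open>\<sigma> t / 2\<close> across it. \<open>V t\<close> is its \<open>t\<close>-derivative.\<close>
  define Z where "Z = (\<lambda>t (w :: real \<times> real \<times> real).
      m + frame_map e u v (t / 2 * fst w, \<sigma> t / 2 * fst (snd w), \<sigma> t / 2 * snd (snd w)))"
  define V where "V = (\<lambda>t (w :: real \<times> real \<times> real).
      frame_map e u v (1 / 2 * fst w, t / (2 * \<sigma> t) * fst (snd w), t / (2 * \<sigma> t) * snd (snd w)))"
  let ?B = "cball (0 :: real \<times> real \<times> real) 1"
  have [measurable]: "?B \<in> sets borel" by simp
  have Zm [measurable]: "Z t \<in> borel_measurable borel" for t
    unfolding Z_def frame_map_def split_beta by (intro borel_measurable_continuous_onI continuous_intros)
  have Vm [measurable]: "V t \<in> borel_measurable borel" for t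
    unfolding V_def frame_map_def split_beta by (intro borel_measurable_continuous_onI continuous_intros)
  have half: "(d / 2) *\<^sub>R e = (1/2) *\<^sub>R (y - x)" using d by (simp add: e_def)
  have foc: "norm (Z t w - x) + norm (Z t w - y) \<le> t \<longleftrightarrow> w \<in> ?B" if t: "t > d" for t w
  proof -
    obtain r p q where w: "w = (r, p, q)" by (cases w)
    have "m - x = (d / 2) *\<^sub>R e" "m - y = - ((d / 2) *\<^sub>R e)"
      unfolding half m_def by (simp_all add: vec_eq_iff field_simps)
    hence zx: "Z t w - x = frame_map e u v (t / 2 * r + d / 2, \<sigma> t / 2 * p, \<sigma> t / 2 * q)"
      and zy: "Z t w - y = frame_map e u v (t / 2 * r - d / 2, \<sigma> t / 2 * p, \<sigma> t / 2 * q)"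
      by (auto simp: Z_def w frame_map_def algebra_simps)
    have "norm (Z t w - x) + norm (Z t w - y) \<le> t \<longleftrightarrow> r\<^sup>2 + (p\<^sup>2 + q\<^sup>2) \<le> 1"
    proof (rule ellipsoid_coordinates)
      show "(norm (Z t w - x))\<^sup>2 = (t / 2 * r + d / 2)\<^sup>2 + (t\<^sup>2 - d\<^sup>2) / 4 * (p\<^sup>2 + q\<^sup>2)"
        unfolding zx norm_frame_map[OF on] sp(2)[OF t, symmetric]
        by (simp add: power_mult_distrib power_divide algebra_simps)
      show "(norm (Z t w - y))\<^sup>2 = (t / 2 * r - d / 2)\<^sup>2 + (t\<^sup>2 - d\<^sup>2) / 4 * (p\<^sup>2 + q\<^sup>2)"
        unfolding zy norm_frame_map[OF on] sp(2)[OF t, symmetric]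
        by (simp add: power_mult_distrib power_divide algebra_simps)
    qed (use d t in auto)
    thus ?thesis unfolding w cball_triple .
  qed
  \<comment> \<open>The change of variables \<open>Z t\<close> turns the integral into \<open>J t * N t\<close> with the Jacobian \<open>J t\<close>.\<close>
  define N where "N = (\<lambda>t. \<integral>w. indicator ?B w * a (Z t w) \<partial>lborel)"
  define N' where "N' = (\<lambda>t. \<integral>w. indicator ?B w * (gradient a (Z t w) \<bullet> V t w) \<partial>lborel)"
  define J where "J = (\<lambda>t::real. t * (t\<^sup>2 - d\<^sup>2) / 8)"
  have F_eq: "ell_int 0 t x y a = J t * N t" if t: "t > d" for t
  proof -
    have "ell_int 0 t x y a = \<bar>t / 2\<bar> * (\<sigma> t / 2)\<^sup>2 *
       (\<integral>(r, p, q). trunc_power 0 t (norm (Z t (r, p, q) - x) + norm (Z t (r, p, q) - y))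
         * a (Z t (r, p, q)) \<partial>lborel)"
      unfolding ell_int_def Z_def fst_conv snd_conv
      by (rule integral_frame_scaled[OF on]) (use t d sp[OF t] in auto)
    also have "(\<integral>(r, p, q). trunc_power 0 t (norm (Z t (r, p, q) - x) + norm (Z t (r, p, q) - y))
      * a (Z t (r, p, q)) \<partial>lborel) = N t"
      unfolding N_def
      by (rule Bochner_Integration.integral_cong) (auto simp: trunc_power_def foc[OF t] indicator_def)
    finally show ?thesis using t d sp(2)[OF t] by (simp add: J_def power_divide)
  qed
  have vol: "integrable lborel (indicator ?B :: _ \<Rightarrow> real)"
    by (rule integrable_real_indicator) (auto simp: emeasure_lborel_cball_finite[unfolded infinity_ennreal_def])
  have Vb: "norm (V t w) \<le> 1 / 2 + t / \<sigma> t" if t: "t > d" and w: "w \<in> ?B" for t w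
  proof -
    obtain r p q where w': "w = (r, p, q)" by (cases w)
    note b = cball_triple_bounds[OF w[unfolded w']]
    have "norm (V t w) \<le> \<bar>1 / 2 * r\<bar> + \<bar>t / (2 * \<sigma> t) * p\<bar> + \<bar>t / (2 * \<sigma> t) * q\<bar>"
      unfolding V_def w' fst_conv snd_conv by (rule norm_frame_map_le[OF on])
    also have "\<dots> \<le> 1 / 2 * 1 + t / (2 * \<sigma> t) * 1 + t / (2 * \<sigma> t) * 1"
      unfolding abs_mult using b t d sp(1)[OF t] by (intro add_mono mult_mono) auto
    finally show ?thesis by simp
  qed
  have dN: "(N has_real_derivative N' t0) (at t0)" if t0: "t0 > d" for t0
  proof -
    define h where "h = t0 - d"
    have h: "h > 0" using t0 by (simp add: h_def)
    define L where "L = M * (1 / 2 + (2 * t0 + h) / \<sigma> t0)"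
    have gi: "integrable lborel (\<lambda>w. indicator ?B w * a (Z t w))" for t
    proof (rule integrable_bounded_support[where M = A and S = ?B])
      show "\<bar>indicator ?B w * a (Z t w)\<bar> \<le> A" for w using A by (auto simp: indicator_def)
    qed (auto simp: indicator_def)
    have der: "AE w in lborel. ((\<lambda>t. indicator ?B w * a (Z t w)) has_real_derivative
        indicator ?B w * (gradient a (Z t0 w) \<bullet> V t0 w)) (at t0)"
    proof (rule AE_I2)
      fix w
      have sd: "(\<sigma> has_real_derivative t0 / \<sigma> t0) (at t0)"
        unfolding \<sigma>_def using t0 d sp(1)[OF t0] by (auto intro!: derivative_eq_intros simp: \<sigma>_def field_simps)
      have "((\<lambda>t. Z t w) has_vector_derivative V t0 w) (at t0)"
        unfolding Z_def V_def frame_map_def prod.case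
        by (auto intro!: derivative_eq_intros sd[THEN
          has_real_derivative_iff_has_vector_derivative[THEN iffD1]] sd simp: algebra_simps)
      hence "((\<lambda>t. Z t w) has_derivative (\<lambda>h. h *\<^sub>R V t0 w)) (at t0)"
        by (simp add: has_vector_derivative_def)
      moreover have "(a has_derivative (\<lambda>h. h \<bullet> gradient a (Z t0 w))) (at (Z t0 w))"
        using gd by (simp add: gderiv_def)
      ultimately have "((\<lambda>t. a (Z t w)) has_derivative (\<lambda>h. (h *\<^sub>R V t0 w) \<bullet> gradient a (Z t0 w))) (at t0)"
        by (rule has_derivative_compose)
      hence "((\<lambda>t. a (Z t w)) has_real_derivative (gradient a (Z t0 w) \<bullet> V t0 w)) (at t0)"
        by (simp add: has_field_derivative_def inner_commute mult_commute_abs)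
      thus "((\<lambda>t. indicator ?B w * a (Z t w)) has_real_derivative
        indicator ?B w * (gradient a (Z t0 w) \<bullet> V t0 w)) (at t0)" by (rule DERIV_cmult)
    qed
    have lip: "\<bar>indicator ?B w * a (Z t w) - indicator ?B w * a (Z t0 w)\<bar> \<le> L * indicator ?B w * \<bar>t - t0\<bar>"
      if th: "\<bar>t - t0\<bar> < h" for t w
    proof (cases "w \<in> ?B")
      case True
      obtain r p q where w: "w = (r, p, q)" by (cases w)
      note b = cball_triple_bounds[OF True[unfolded w]]
      have t: "t > d" using th by (auto simp: h_def)
      have "\<bar>\<sigma> t - \<sigma> t0\<bar> * \<sigma> t0 \<le> \<bar>\<sigma> t - \<sigma> t0\<bar> * (\<sigma> t + \<sigma> t0)"
        using sp(1)[OF t] by (intro mult_left_mono) auto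
      also have "\<dots> = \<bar>(\<sigma> t)\<^sup>2 - (\<sigma> t0)\<^sup>2\<bar>"
        using sp(1)[OF t] sp(1)[OF t0] by (simp add: square_diff_square_factored power2_eq_square abs_mult)
      also have "\<dots> = \<bar>t - t0\<bar> * \<bar>t + t0\<bar>"
        unfolding sp(2)[OF t] sp(2)[OF t0] by (simp add: abs_mult[symmetric] power2_eq_square algebra_simps)
      also have "\<dots> \<le> \<bar>t - t0\<bar> * (2 * t0 + h)"
        using th t t0 d by (intro mult_left_mono) auto
      finally have s: "\<bar>\<sigma> t - \<sigma> t0\<bar> \<le> (2 * t0 + h) / \<sigma> t0 * \<bar>t - t0\<bar>"
        using sp(1)[OF t0] by (simp add: field_simps)
      have "Z t w - Z t0 w = frame_map e u v ((t - t0) / 2 * r, (\<sigma> t - \<sigma> t0) / 2 * p, (\<sigma> t - \<sigma> t0) / 2 * q)"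
        by (simp add: Z_def w frame_map_diff field_simps)
      hence "norm (Z t w - Z t0 w) \<le> \<bar>(t - t0) / 2 * r\<bar> + \<bar>(\<sigma> t - \<sigma> t0) / 2 * p\<bar> + \<bar>(\<sigma> t - \<sigma> t0) / 2 * q\<bar>"
        by (simp only: norm_frame_map_le[OF on])
      also have "\<dots> \<le> \<bar>(t - t0) / 2\<bar> * 1 + \<bar>(\<sigma> t - \<sigma> t0) / 2\<bar> * 1 + \<bar>(\<sigma> t - \<sigma> t0) / 2\<bar> * 1"
        unfolding abs_mult using b by (intro add_mono mult_left_mono) auto
      also have "\<dots> \<le> (1 / 2 + (2 * t0 + h) / \<sigma> t0) * \<bar>t - t0\<bar>"
        using s by (simp add: distrib_right)
      finally have "M * norm (Z t w - Z t0 w) \<le> L * \<bar>t - t0\<bar>"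
        unfolding L_def using M(1) by (simp add: mult.assoc mult_left_mono)
      with M(3)[of "Z t w" "Z t0 w"] show ?thesis using True by simp
    qed simp
    have Ci: "integrable lborel (\<lambda>w. L * indicator ?B w)" using vol by simp
    show ?thesis
      unfolding N_def N'_def
      by (rule has_real_derivative_integral[of h t0 lborel "\<lambda>t w. indicator ?B w
        * a (Z t w)" _ "\<lambda>w. L * indicator ?B w",
            OF h gi der lip Ci]) measurable
  qed
  have N'_bound: "\<bar>N' t\<bar> \<le> M * (1 / 2 + t / \<sigma> t) * measure lborel ?B" if t: "t > d" for t
  proof -
    let ?b = "M * (1 / 2 + t / \<sigma> t)"
    have b0: "0 \<le> ?b" using M(1) t d sp(1)[OF t] by auto
    have bb: "\<bar>indicator ?B w * (gradient a (Z t w) \<bullet> V t w)\<bar> \<le> ?b * indicator ?B w" for w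
    proof (cases "w \<in> ?B")
      case True
      have "\<bar>gradient a (Z t w) \<bullet> V t w\<bar> \<le> norm (gradient a (Z t w)) * norm (V t w)"
        by (rule Cauchy_Schwarz_ineq2)
      also have "\<dots> \<le> ?b" using M Vb[OF t True] by (intro mult_mono) auto
      finally show ?thesis using True by simp
    qed simp
    have "\<bar>N' t\<bar> \<le> (\<integral>w. ?b * indicator ?B w \<partial>lborel)"
      unfolding N'_def
    proof (rule integral_abs_bound[THEN order_trans], rule integral_mono)
      show i2: "integrable lborel (\<lambda>w. ?b * indicator ?B w)" using vol by simp
      show "integrable lborel (\<lambda>w. \<bar>indicator ?B w * (gradient a (Z t w) \<bullet> V t w)\<bar>)"
      proof (rule Bochner_Integration.integrable_bound[OF i2])
        show "AE w in lborel. norm \<bar>indicator ?B w * (gradient a (Z t w) \<bullet> V t w)\<bar> \<le> norm (?b * indicator ?B w)"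
          using order_trans[OF bb abs_ge_self] by (intro AE_I2) (simp only: real_norm_def abs_idempotent)
      qed measurable
    qed (rule bb)
    also have "\<dots> = ?b * measure lborel ?B" by simp
    finally show ?thesis .
  qed
  have Nc: "isCont N d"
    unfolding N_def
  proof (rule isCont_integral[where C = "\<lambda>w. A * indicator ?B w"])
    have "isCont (\<lambda>t. indicator ?B w * a (Z t w)) d" for w
    proof -
      have "isCont (\<lambda>t. Z t w) d"
        unfolding Z_def frame_map_def prod.case \<sigma>_def by (intro continuous_intros) auto
      moreover have "isCont a (Z d w)" using cont by (simp add: continuous_on_eq_continuous_at)
      ultimately have "isCont (\<lambda>t. a (Z t w)) d" by (rule isCont_o2)
      thus ?thesis by (intro continuous_intros)
    qed
    thus "AE w in lborel. isCont (\<lambda>t. indicator ?B w * a (Z t w)) d" by simp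
    show "\<bar>indicator ?B w * a (Z t w)\<bar> \<le> A * indicator ?B w" for t w
      using A by (auto simp: indicator_def)
  qed (use vol in auto)
  have Nd: "N d = (\<integral>r. indicator {-1..1} r * (pi * (1 - r\<^sup>2) * a (m + (r / 2) *\<^sub>R (y - x))) \<partial>lborel)"
  proof -
    have "Z d w = m + (fst w / 2) *\<^sub>R (y - x)" for w
      using d by (simp add: Z_def frame_map_def \<sigma>_def e_def)
    hence "N d = (\<integral>w. indicator ?B w * a (m + (fst w / 2) *\<^sub>R (y - x)) \<partial>lborel)" by (simp add: N_def)
    also have "\<dots> = (\<integral>r. indicator {-1..1} r * (pi * (1 - r\<^sup>2) * a (m + (r / 2) *\<^sub>R (y - x))) \<partial>lborel)"
      by (rule integral_ball_slices[where M = A]) (use A in auto)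
    finally show ?thesis .
  qed
  define F' where "F' = (\<lambda>t. (3 * t\<^sup>2 - d\<^sup>2) / 8 * N t + J t * N' t)"
  show ?thesis
  proof (rule that[of F'])
    fix t assume t: "t > d"
    have "(J has_real_derivative (3 * t\<^sup>2 - d\<^sup>2) / 8) (at t)"
      unfolding J_def by (auto intro!: derivative_eq_intros simp: field_simps power2_eq_square)
    from DERIV_mult[OF this dN[OF t]]
    have "((\<lambda>t. J t * N t) has_real_derivative F' t) (at t)"
      by (simp add: F'_def mult.commute)
    thus "((\<lambda>t. ell_int 0 t x y a) has_real_derivative F' t) (at t)"
      by (rule has_field_derivative_transform_within_open[of _ _ _ "{d<..}"]) (use t F_eq in auto)
  next
    have Nlim: "(N \<longlongrightarrow> N d) (at_right d)"
      using Nc by (simp add: isCont_def filterlim_at_split)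
    \<comment> \<open>\<open>V t\<close> blows up like \<open>1 / \<sigma> t\<close> as \<open>t\<close> decreases to \<open>d\<close>, but \<open>J t\<close> vanishes like \<open>(\<sigma> t)\<^sup>2\<close>.\<close>
    have JN: "((\<lambda>t. J t * N' t) \<longlongrightarrow> 0) (at_right d)"
    proof (rule Lim_null_comparison)
      let ?b = "\<lambda>t. t / 8 * M * measure lborel ?B * ((\<sigma> t)\<^sup>2 / 2 + t * \<sigma> t)"
      show "\<forall>\<^sub>F t in at_right d. norm (J t * N' t) \<le> ?b t"
        using eventually_at_right_less
      proof eventually_elim
        fix t assume t: "d < t"
        have J: "J t = t / 8 * (\<sigma> t)\<^sup>2" by (simp add: J_def sp(2)[OF t])
        have "norm (J t * N' t) = t / 8 * (\<sigma> t)\<^sup>2 * \<bar>N' t\<bar>" using t d by (simp add: J abs_mult)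
        also have "\<dots> \<le> t / 8 * (\<sigma> t)\<^sup>2 * (M * (1 / 2 + t / \<sigma> t) * measure lborel ?B)"
          using t d by (intro mult_left_mono N'_bound) auto
        also have "\<dots> = ?b t" using sp(1)[OF t] by (simp add: field_simps power2_eq_square)
        finally show "norm (J t * N' t) \<le> ?b t" .
      qed
      have "(?b \<longlongrightarrow> d / 8 * M * measure lborel ?B * ((\<sigma> d)\<^sup>2 / 2 + d * \<sigma> d)) (at_right d)"
        unfolding \<sigma>_def by (intro tendsto_intros) auto
      thus "(?b \<longlongrightarrow> 0) (at_right d)" by (simp add: \<sigma>_def)
    qed
    have "(F' \<longlongrightarrow> (3 * d\<^sup>2 - d\<^sup>2) / 8 * N d + 0) (at_right d)"
      unfolding F'_def by (intro tendsto_add JN tendsto_mult Nlim tendsto_intros) auto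
    also have "(3 * d\<^sup>2 - d\<^sup>2) / 8 * N d + 0 = d\<^sup>2 / 4 * N d" by simp
    also have "\<dots> = (\<integral>r. d\<^sup>2 / 4 * (indicator {-1..1} r * (pi * (1 - r\<^sup>2) * a (m + (r / 2)
      *\<^sub>R (y - x)))) \<partial>lborel)"
      unfolding Nd by simp
    also have "\<dots> = (\<integral>r. indicator {-1..1} r * (d\<^sup>2 / 4 * pi * (1 - r\<^sup>2)
            * a ((1/2) *\<^sub>R (x + y) + (r / 2) *\<^sub>R (y - x))) \<partial>lborel)"
      unfolding m_def by (simp add: mult_ac)
    finally show "(F' \<longlongrightarrow> (\<integral>r. indicator {-1..1} r * (d\<^sup>2 / 4 * pi * (1 - r\<^sup>2)
            * a ((1/2) *\<^sub>R (x + y) + (r / 2) *\<^sub>R (y - x))) \<partial>lborel)) (at_right d)" .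
  qed
qed

text \<open>The integral of \<open>g\<close> over the segment from \<open>x\<close> to \<open>y\<close>, parametrized over \<open>[-1, 1]\<close>; this is twice
the mean of \<open>g\<close> on the segment.\<close>

definition seg_mean :: "(real^3 \<Rightarrow> real) \<Rightarrow> real^3 \<Rightarrow> real^3 \<Rightarrow> real" where
  "seg_mean g x y = (\<integral>r. indicator {-1..1} r * g ((1/2) *\<^sub>R (x + y) + (r / 2) *\<^sub>R (y - x)) \<partial>lborel)"

text \<open>The product of the distances to the foci cancels the area of the slices. At \<open>r = \<plusminus>1\<close> the point is
a focus; there both sides vanish.\<close>

lemma ellipsoid_collapse_density:
  fixes x y :: "real^3" and \<alpha> :: "real^3 \<Rightarrow> real"
  assumes a: "\<alpha> x = 0" "\<alpha> y = 0" and xy: "y \<noteq> x"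
  defines "z \<equiv> \<lambda>r. (1/2) *\<^sub>R (x + y) + (r / 2) *\<^sub>R (y - x)"
  assumes r: "r \<in> {-1..1}"
  shows "(norm (y - x))\<^sup>2 / 4 * pi * (1 - r\<^sup>2) * (\<alpha> (z r) / norm (z r - x) / norm (z r - y)) = pi * \<alpha> (z r)"
proof -
  have zx: "z r - x = ((1 + r) / 2) *\<^sub>R (y - x)" and zy: "z r - y = - (((1 - r) / 2) *\<^sub>R (y - x))"
    unfolding z_def vec_eq_iff by (simp_all add: field_simps)
  consider "r = 1" | "r = -1" | "-1 < r" "r < 1" using r by fastforce
  thus ?thesis
  proof cases
    case 1
    hence "z r = y" using zy by simp
    thus ?thesis using a by simp
  next
    case 2
    hence "z r = x" using zx by simp
    thus ?thesis using a by simp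
  next
    case 3
    have n: "norm (z r - x) = (1 + r) / 2 * norm (y - x)" "norm (z r - y) = (1 - r) / 2 * norm (y - x)"
      unfolding zx zy using 3 by simp_all
    have "(1 - r\<^sup>2) = (1 + r) * (1 - r)" by (simp add: power2_eq_square algebra_simps)
    moreover have "1 + r \<noteq> 0" "1 - r \<noteq> 0" "norm (y - x) \<noteq> 0" using 3 xy by auto
    ultimately show ?thesis unfolding n by (simp add: power2_eq_square)
  qed
qed

text \<open>The limit at small times is, up to a constant, the product of the source and a segment integral of \<open>\<alpha>\<close>.\<close>

lemma data_M0_eq:
  assumes f: "C_k_c 0 f" and a: "C_k_c 1 \<alpha>" and r: "C_k_c 1 \<rho>"
    and x: "x \<notin> supp f" "x \<notin> supp \<alpha>" "x \<notin> supp \<rho>"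
    and y: "y \<notin> supp \<alpha>" "y \<notin> supp \<rho>" "y \<noteq> x"
  shows "data_M0 \<epsilon> f \<alpha> \<rho> x y = \<epsilon> / (16 * pi) * seg_mean \<alpha> x y * f y"
proof -
  define d where "d = norm (y - x)"
  have d: "d > 0" using y by (simp add: d_def)
  have a0: "C_k_c 0 \<alpha>" using a C_k_c_1_imp_0 by simp
  have cr: "compact (supp \<rho>)" using r by (auto simp: C_k_c_def)
  let ?A = "\<lambda>z. weight_\<alpha> \<epsilon> \<alpha> x z \<bullet> (1 / norm (z - y))"
  let ?B = "\<lambda>z. weight_\<rho> \<epsilon> \<rho> x z \<bullet> ((z - y) /\<^sub>R (norm (z - y))\<^sup>2)"
  let ?C = "\<lambda>z. weight_\<rho> \<epsilon> \<rho> x z \<bullet> ((z - y) /\<^sub>R norm (z - y) ^ 3)"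
  let ?h = "\<lambda>z. \<alpha> z / norm (z - x) / norm (z - y)"
  define c where "c = \<epsilon> / (16 * pi\<^sup>2)"
  have W0: "weight_\<rho> \<epsilon> \<rho> x z \<bullet> w = 0" if "z \<notin> supp \<rho>" for z w
    using that by (simp add: weight_\<rho>_def gradient_not_in_supp)
  have iB: "integrable lborel ?B" 
    by (rule integrable_continuous_compact[OF continuous_density_\<rho>[OF r x(3) y(2)] cr W0])
  have iC: "integrable lborel ?C"
    by (rule integrable_continuous_compact[OF continuous_density_\<rho>[OF r x(3) y(2)] cr W0])
  have "supp (\<lambda>z. \<alpha> z / norm (z - x)) \<subseteq> supp \<alpha>"
    by (rule supp_subset[OF _ closed_supp]) (auto, metis not_in_supp)
  hence "C_k_c 1 ?h"
    using y(1) by (intro C_k_c_1_over_norm a x(2)) auto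
  then obtain F' where F': "\<And>t. t > d \<Longrightarrow> ((\<lambda>t. ell_int 0 t x y ?h) has_real_derivative F' t) (at t)"
    and L: "(F' \<longlongrightarrow> (\<integral>r. indicator {-1..1} r * (d\<^sup>2 / 4 * pi * (1 - r\<^sup>2)
            * ?h ((1/2) *\<^sub>R (x + y) + (r / 2) *\<^sub>R (y - x))) \<partial>lborel)) (at_right d)"
    unfolding d_def using ell_int_0_derivative[OF _ y(3), of ?h] by blast
  have "(\<integral>r. indicator {-1..1} r * (d\<^sup>2 / 4 * pi * (1 - r\<^sup>2)
            * ?h ((1/2) *\<^sub>R (x + y) + (r / 2) *\<^sub>R (y - x))) \<partial>lborel)
      = (\<integral>r. pi * (indicator {-1..1} r * \<alpha> ((1/2) *\<^sub>R (x + y) + (r / 2) *\<^sub>R (y - x))) \<partial>lborel)"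
  proof (rule Bochner_Integration.integral_cong)
    fix r :: real
    show "indicator {-1..1} r * (d\<^sup>2 / 4 * pi * (1 - r\<^sup>2) * ?h ((1/2) *\<^sub>R (x + y) + (r / 2) *\<^sub>R (y - x)))
      = pi * (indicator {-1..1} r * \<alpha> ((1/2) *\<^sub>R (x + y) + (r / 2) *\<^sub>R (y - x)))"
    proof (cases "r \<in> {-1..1}")
      case True
      show ?thesis
        unfolding d_def ellipsoid_collapse_density[OF not_in_supp[OF x(2)] not_in_supp[OF y(1)] y(3) True]
        by simp
    qed simp
  qed simp
  hence L: "(F' \<longlongrightarrow> pi * seg_mean \<alpha> x y) (at_right d)" using L by (simp add: seg_mean_def)
  let ?g = "\<lambda>t. radon_inv (measurement \<epsilon> f \<alpha> \<rho> t x) y"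
  define p where "p = (\<lambda>t. ((t - d)\<^sup>2 / (8 * pi * d) + c * ell_int 0 t x y ?h
      + ell_int (Suc 0) t x y ?B + ell_int (Suc 1) t x y ?C / 2) * f y)"
  define p' where "p' = (\<lambda>t. ((t - d) / (4 * pi * d) + c * F' t
      + ell_int 0 t x y ?B + ell_int 1 t x y ?C) * f y)"
  \<comment> \<open>Only the term with \<open>\<alpha>\<close> over the ellipsoid has a nonzero derivative in the limit.\<close>
  have g_eq: "?g t = p t" if t: "t > d" for t
  proof -
    have "ell_int 0 t x y ?A = ell_int 0 t x y (\<lambda>z. c * ?h z)"
      by (simp add: weight_\<alpha>_def c_def mult_ac)
    also have "\<dots> = c * ell_int 0 t x y ?h"
      unfolding ell_int_def integral_mult_right_zero[symmetric]
      by (rule Bochner_Integration.integral_cong) (simp_all only: mult_ac)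
    finally show ?thesis
      using t by (simp add: radon_inv_measurement[OF f a0 r x] kernel_eq not_in_supp[OF y(1)] p_def d_def
          numeral_2_eq_2)
  qed
  have dp: "(p has_real_derivative p' t) (at t)" if t: "t > d" for t
  proof -
    have "((\<lambda>t. (t - d)\<^sup>2 / (8 * pi * d)) has_real_derivative (t - d) / (4 * pi * d)) (at t)"
      using d by (auto intro!: derivative_eq_intros simp: field_simps)
    moreover have "((\<lambda>t. c * ell_int 0 t x y ?h) has_real_derivative c * F' t) (at t)"
      by (rule DERIV_cmult[OF F'[OF t]])
    moreover have "((\<lambda>t. ell_int (Suc 0) t x y ?B) has_real_derivative ell_int 0 t x y ?B) (at t)"
      using has_real_derivative_ell_int[OF iB, of 0] by simp
    moreover have "((\<lambda>t. ell_int (Suc 1) t x y ?C / 2) has_real_derivative ell_int 1 t x y ?C) (at t)"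
      using DERIV_cdivide[OF has_real_derivative_ell_int[OF iC, where j = 1 and x = x and y
        = y and ?t0.0 = t], of 2] by simp
    ultimately show ?thesis
      unfolding p_def p'_def by (intro DERIV_cmult_right DERIV_add)
  qed
  have dg: "deriv ?g t = p' t" if "t > d" for t
    by (rule deriv_eqI_open[of "{d<..}" _ _ p]) (use that g_eq dp in auto)
  have lB: "((\<lambda>t. ell_int 0 t x y ?B) \<longlongrightarrow> 0) (at_right d)"
    using isCont_ell_int_0[OF iB, where x = x and y = y and ?t0.0 = d] ell_int_eq_0[where t
      = d and x = x and y = y and j = 0]
    by (simp add: isCont_def filterlim_at_split d_def)
  have lC: "((\<lambda>t. ell_int 1 t x y ?C) \<longlongrightarrow> 0) (at_right d)"
    using DERIV_isCont[OF has_real_derivative_ell_int[OF iC, where j = 0 and x = x and y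
      = y and ?t0.0 = d]] ell_int_eq_0[where t = d and x = x and y = y and j = 1]
    by (simp add: isCont_def filterlim_at_split d_def)
  have "((\<lambda>t. (t - d) / (4 * pi * d)) \<longlongrightarrow> (d - d) / (4 * pi * d)) (at_right d)"
    using d by (intro tendsto_intros) auto
  hence "(p' \<longlongrightarrow> ((d - d) / (4 * pi * d) + c * (pi * seg_mean \<alpha> x y) + 0 + 0) * f y) (at_right d)"
    unfolding p'_def by (intro tendsto_mult tendsto_add lB lC L tendsto_const)
  moreover have "c * pi = \<epsilon> / (16 * pi)" by (simp add: c_def power2_eq_square)
  ultimately have "(p' \<longlongrightarrow> \<epsilon> / (16 * pi) * seg_mean \<alpha> x y * f y) (at_right d)"
    by (simp add: mult.assoc[symmetric])
  hence "(deriv ?g \<longlongrightarrow> \<epsilon> / (16 * pi) * seg_mean \<alpha> x y * f y) (at_right d)"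
    by (rule Lim_transform_eventually)
       (auto simp: dg intro: eventually_mono[OF eventually_at_right_less])
  thus ?thesis unfolding data_M0_def d_def by (intro tendsto_Lim) auto
qed

section \<open>Recovering the line integrals\<close>

lemma isCont_seg_mean:
  assumes "C_k_c 0 g"
  shows "isCont (seg_mean g x) y"
proof -
  have cont: "continuous_on UNIV g" and comp: "compact (supp g)" using assms by (auto simp: C_k_c_0_iff)
  obtain A where A: "0 \<le> A" "\<And>z. \<bar>g z\<bar> \<le> A"
    using continuous_supp_bounded[OF cont comp] not_in_supp by (metis real_norm_def)
  have [measurable]: "g \<in> borel_measurable borel" by (rule borel_measurable_continuous_onI[OF cont])
  show ?thesis
    unfolding seg_mean_def[abs_def]
  proof (rule isCont_integral[where C = "\<lambda>r. A * indicator {-1..1} r"])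
    have "isCont (\<lambda>y. indicator {-1..1} r * g ((1/2) *\<^sub>R (x + y) + (r / 2) *\<^sub>R (y - x))) y" for r :: real
    proof -
      have "isCont (\<lambda>y. (1/2) *\<^sub>R (x + y) + (r / 2) *\<^sub>R (y - x)) y" by (intro continuous_intros)
      moreover have "isCont g ((1/2) *\<^sub>R (x + y) + (r / 2) *\<^sub>R (y - x))"
        using cont by (simp add: continuous_on_eq_continuous_at)
      ultimately have "isCont (\<lambda>y. g ((1/2) *\<^sub>R (x + y) + (r / 2) *\<^sub>R (y - x))) y" by (rule isCont_o2)
      thus ?thesis by (rule isCont_mult[OF continuous_const])
    qed
    thus "AE r in lborel. isCont (\<lambda>y. indicator {-1..1} r * g ((1/2) *\<^sub>R (x + y) + (r / 2) *\<^sub>R (y - x))) y"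
      by simp
    show "\<bar>indicator {-1..1} r * g ((1/2) *\<^sub>R (x + y) + (r / 2) *\<^sub>R (y - x))\<bar> \<le> A * indicator {-1..1} r" for y r
      using A by (auto simp: indicator_def)
  qed auto
qed

lemma xray_eq_seg_mean:
  assumes s: "s1 < s2" and out: "\<And>s. s < s1 \<or> s > s2 \<Longrightarrow> g (y + s *\<^sub>R v) = 0"
  shows "xray g y v = (s2 - s1) / 2 * seg_mean g (y + s1 *\<^sub>R v) (y + s2 *\<^sub>R v)"
proof -
  define c where "c = (s2 - s1) / 2"
  have c: "c > 0" using s by (simp add: c_def)
  have "xray g y v = \<bar>c\<bar> *\<^sub>R (\<integral>r. g (y + ((s1 + s2) / 2 + c * r) *\<^sub>R v) \<partial>lborel)"
    unfolding xray_def by (rule lborel_integral_real_affine) (use c in simp)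
  also have "(\<lambda>r. g (y + ((s1 + s2) / 2 + c * r) *\<^sub>R v))
    = (\<lambda>r. indicator {-1..1} r *
        g ((1/2) *\<^sub>R ((y + s1 *\<^sub>R v) + (y + s2 *\<^sub>R v))
          + (r / 2) *\<^sub>R ((y + s2 *\<^sub>R v) - (y + s1 *\<^sub>R v))))"
  proof
    fix r
    have eq: "(1/2) *\<^sub>R ((y + s1 *\<^sub>R v) + (y + s2 *\<^sub>R v)) + (r / 2) *\<^sub>R ((y + s2 *\<^sub>R v) - (y + s1 *\<^sub>R v))
        = y + ((s1 + s2) / 2 + c * r) *\<^sub>R v"
      unfolding c_def vec_eq_iff by (simp add: field_simps)
    have "g (y + ((s1 + s2) / 2 + c * r) *\<^sub>R v) = 0" if "r \<notin> {-1..1}"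
    proof (rule out)
      from that consider "r < -1" | "r > 1" by fastforce
      thus "(s1 + s2) / 2 + c * r < s1 \<or> (s1 + s2) / 2 + c * r > s2"
      proof cases
        case 1
        hence "c * r < c * (-1)" using c by (intro mult_strict_left_mono) auto
        thus ?thesis by (simp add: c_def field_simps)
      next
        case 2
        hence "c * 1 < c * r" using c by (intro mult_strict_left_mono) auto
        thus ?thesis by (simp add: c_def field_simps)
      qed
    qed
    thus "g (y + ((s1 + s2) / 2 + c * r) *\<^sub>R v) = indicator {-1..1} r *
        g ((1/2) *\<^sub>R ((y + s1 *\<^sub>R v) + (y + s2 *\<^sub>R v))
          + (r / 2) *\<^sub>R ((y + s2 *\<^sub>R v) - (y + s1 *\<^sub>R v)))"
      unfolding eq by (cases "r \<in> {-1..1}") auto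
  qed
  finally show ?thesis using c by (simp add: seg_mean_def c_def)
qed

lemma admissibleD:
  assumes "admissible D f \<alpha> \<rho>"
  shows "C_k_c 0 f" "C_k_c 1 \<alpha>" "C_k_c 1 \<rho>" "supp f \<subseteq> D"
    "supp \<alpha> \<union> supp \<rho> \<subseteq> interior (supp f)" "supp \<alpha> \<subseteq> D" "supp \<rho> \<subseteq> D" "compact (supp \<alpha> \<union> supp \<rho>)"
proof -
  \<comment> \<open>\<open>\<alpha>\<close> is twice differentiable; one continuous derivative suffices below.\<close>
  show "C_k_c 1 \<alpha>"
    using assms C_k_Suc_imp[of 1 \<alpha>] by (simp add: admissible_def C_k_c_def numeral_2_eq_2 del: C_k.simps)
  show 1: "C_k_c 0 f" "C_k_c 1 \<rho>" "supp f \<subseteq> D" and 2: "supp \<alpha> \<union> supp \<rho> \<subseteq> interior (supp f)"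
    and "compact (supp \<alpha> \<union> supp \<rho>)"
    using assms by (auto simp: admissible_def C_k_c_def)
  show "supp \<alpha> \<subseteq> D" "supp \<rho> \<subseteq> D" using 1 2 interior_subset by blast+
qed

text \<open>The data determine the integrals over segments that start at a detector position and end in the
interior of the support of \<open>f\<close>, outside the supports of the coefficients. Where \<open>f\<close> vanishes this is
by continuity.\<close>

lemma seg_means_agree:
  assumes D: "open D" and adm: "admissible D f \<alpha> \<rho>" and adm': "admissible D f' \<alpha>' \<rho>'"
    and \<epsilon>: "\<epsilon> > 0" and x: "x \<in> frontier D"
    and M0: "\<And>y. y \<noteq> x \<Longrightarrow> data_M0 \<epsilon> f \<alpha> \<rho> x y = data_M0 \<epsilon> f' \<alpha>' \<rho>' x y"
    and N: "\<And>y. y \<noteq> x \<Longrightarrow> data_Ninf \<epsilon> f \<alpha> \<rho> x y = data_Ninf \<epsilon> f' \<alpha>' \<rho>' x y"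
    and y: "y \<notin> supp \<alpha> \<union> supp \<rho> \<union> supp \<alpha>' \<union> supp \<rho>'" "y \<in> interior (supp f)"
  shows "seg_mean \<alpha> x y = seg_mean \<alpha>' x y"
proof -
  note A = admissibleD[OF adm] and A' = admissibleD[OF adm']
  have xD: "x \<notin> D" using x D by (simp add: frontier_def interior_open)
  have xs: "x \<notin> supp f" "x \<notin> supp \<alpha>" "x \<notin> supp \<rho>" using xD A by auto
  have xs': "x \<notin> supp f'" "x \<notin> supp \<alpha>'" "x \<notin> supp \<rho>'" using xD A' by auto
  define U where "U = interior (supp f) \<inter> - (supp \<alpha> \<union> supp \<rho> \<union> supp \<alpha>' \<union> supp \<rho>')"
  have "open U" unfolding U_def using closed_supp by (intro open_Int open_interior open_Compl closed_Un)
  moreover have "y \<in> U \<inter> closure {z. f z \<noteq> 0}"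
    using y interior_subset[of "supp f"] by (auto simp: U_def supp_def)
  ultimately have "y \<in> closure (U \<inter> {z. f z \<noteq> 0})" using open_Int_closure_subset by blast
  moreover have "closure (U \<inter> {z. f z \<noteq> 0}) \<subseteq> {z. seg_mean \<alpha> x z = seg_mean \<alpha>' x z}"
  proof (rule closure_minimal)
    have c: "C_k_c 0 \<alpha>" "C_k_c 0 \<alpha>'" using A(2) A'(2) C_k_c_1_imp_0 by auto
    show "closed {z. seg_mean \<alpha> x z = seg_mean \<alpha>' x z}"
      by (intro closed_Collect_eq continuous_at_imp_continuous_on ballI isCont_seg_mean c)
    show "U \<inter> {z. f z \<noteq> 0} \<subseteq> {z. seg_mean \<alpha> x z = seg_mean \<alpha>' x z}"
    proof
      fix z assume "z \<in> U \<inter> {z. f z \<noteq> 0}"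
      hence fz: "f z \<noteq> 0" and z: "z \<notin> supp \<alpha>" "z \<notin> supp \<rho>" and z': "z \<notin> supp \<alpha>'" "z \<notin> supp \<rho>'"
        by (auto simp: U_def)
      have zx: "z \<noteq> x" using fz xs(1) not_in_supp by blast
      \<comment> \<open>The second datum identifies the two sources at \<open>z\<close>; then the first one can be divided by them.\<close>
      have "f z / (4 * pi) = f' z / (4 * pi)"
        using N[OF zx] data_Ninf_eq[OF A(1) c(1) A(3) xs z zx] data_Ninf_eq[OF A'(1) c(2) A'(3) xs' z' zx]
        by simp
      hence ff: "f' z = f z" by simp
      have "\<epsilon> / (16 * pi) * seg_mean \<alpha> x z * f z = \<epsilon> / (16 * pi) * seg_mean \<alpha>' x z * f' z"
        using M0[OF zx] data_M0_eq[OF A(1-3) xs z zx] data_M0_eq[OF A'(1-3) xs' z' zx] by simp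
      thus "z \<in> {z. seg_mean \<alpha> x z = seg_mean \<alpha>' x z}" using fz \<epsilon> by (simp add: ff)
    qed
  qed
  ultimately show ?thesis by auto
qed

lemma compact_line_section:
  fixes v :: "'a::euclidean_space"
  assumes A: "compact A" and v: "norm v = 1"
  shows "compact {s. y + s *\<^sub>R v \<in> A}"
proof -
  let ?S = "{s. y + s *\<^sub>R v \<in> A}"
  have "closed ?S"
  proof -
    have "closed ((\<lambda>s. y + s *\<^sub>R v) -` A)"
      by (rule closed_vimage) (use A compact_imp_closed in \<open>auto intro!: continuous_intros\<close>)
    thus ?thesis by (simp add: vimage_def)
  qed
  moreover have "bounded ?S"
  proof -
    obtain R where R: "\<And>z. z \<in> A \<Longrightarrow> norm z \<le> R" using A compact_imp_bounded bounded_iff by metis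
    have "norm s \<le> R + norm y" if "s \<in> ?S" for s
    proof -
      have "norm (s *\<^sub>R v) \<le> norm (y + s *\<^sub>R v) + norm y" using norm_triangle_ineq4[of "y + s *\<^sub>R v" y] by simp
      thus ?thesis using R[of "y + s *\<^sub>R v"] that v by simp
    qed
    thus ?thesis unfolding bounded_iff by blast
  qed
  ultimately show ?thesis by (simp add: compact_eq_bounded_closed)
qed

text \<open>The geometric core: segment integrals from the frontier of \<open>D\<close> to points just behind the last
point of the line in \<open>A\<close> are integrals over the whole line.\<close>

lemma xray_eqI:
  assumes D: "open D" "bounded D" and A: "compact A" "A \<subseteq> D" and v: "norm v = 1"
    and out: "\<And>z. z \<notin> A \<Longrightarrow> g z = 0" "\<And>z. z \<notin> A \<Longrightarrow> g' z = 0"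
    and last: "y + s *\<^sub>R v \<in> A" "\<And>s'. s' > s \<Longrightarrow> y + s' *\<^sub>R v \<notin> A"
    and W: "open W" "y + s *\<^sub>R v \<in> W"
    and agree: "\<And>x z. x \<in> frontier D \<Longrightarrow> z \<in> W \<Longrightarrow> z \<notin> A \<Longrightarrow> seg_mean g x z = seg_mean g' x z"
  shows "xray g y v = xray g' y v"
proof -
  define S where "S = {s. y + s *\<^sub>R v \<in> A}"
  have "compact S" unfolding S_def by (rule compact_line_section[OF A(1) v])
  moreover have "S \<noteq> {}" using last by (auto simp: S_def)
  ultimately obtain s0 where s0: "s0 \<in> S" "\<And>s. s \<in> S \<Longrightarrow> s0 \<le> s"
    using compact_attains_inf by metis
  have "y + s0 *\<^sub>R v \<in> interior D" using s0 A D by (auto simp: S_def interior_open)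
  moreover have "- v \<noteq> 0" using v by auto
  ultimately obtain e where e: "0 < e" "(y + s0 *\<^sub>R v) + e *\<^sub>R (- v) \<in> frontier D"
    using ray_to_frontier[OF D(2)] by metis
  define s1 where "s1 = s0 - e"
  have x: "y + s1 *\<^sub>R v \<in> frontier D" using e by (simp add: s1_def algebra_simps)
  \<comment> \<open>The detector position \<open>y + s1 v\<close> lies before the first point of \<open>A\<close> on the line, the source
    position \<open>y + s2 v\<close> just behind the last one.\<close>
  obtain \<delta> where \<delta>: "\<delta> > 0" "ball (y + s *\<^sub>R v) \<delta> \<subseteq> W" using W open_contains_ball by metis
  define s2 where "s2 = s + \<delta> / 2"
  have "dist (y + s *\<^sub>R v) (y + s2 *\<^sub>R v) = norm ((s - s2) *\<^sub>R v)" by (simp add: dist_norm algebra_simps)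
  also have "\<dots> < \<delta>" using \<delta> v by (simp add: s2_def)
  finally have s2W: "y + s2 *\<^sub>R v \<in> W" using \<delta> by auto
  have s2A: "y + s2 *\<^sub>R v \<notin> A" using \<delta> by (intro last) (simp add: s2_def)
  have "s0 \<le> s" using s0 last by (simp add: S_def)
  hence lt: "s1 < s2" using e \<delta> by (simp add: s1_def s2_def)
  have notA: "y + r *\<^sub>R v \<notin> A" if "r < s1 \<or> r > s2" for r
    using that
  proof
    assume "r < s1"
    hence "r \<notin> S" using s0(2)[of r] e by (auto simp: s1_def)
    thus ?thesis by (simp add: S_def)
  next
    assume "r > s2"
    thus ?thesis using \<delta> by (intro last) (simp add: s2_def)
  qed
  show ?thesis
    using xray_eq_seg_mean[OF lt, of g y v] xray_eq_seg_mean[OF lt, of g' y v] notA out agree[OF x s2W s2A]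
    by simp
qed

theorem proposition5p1:
  fixes D \<Sigma> :: "(real^3) set"
    and \<epsilon> :: real
    and f \<alpha> \<rho> f' \<alpha>' \<rho>' :: "real^3 \<Rightarrow> real"
  assumes "open D" and "bounded D" and "\<Sigma> = frontier D"
    and "\<epsilon> > 0"
    and "admissible D f \<alpha> \<rho>"
    and "admissible D f' \<alpha>' \<rho>'"
    and "\<And>x y. x \<in> \<Sigma> \<Longrightarrow> y \<noteq> x \<Longrightarrow> data_M0 \<epsilon> f \<alpha> \<rho> x y = data_M0 \<epsilon> f' \<alpha>' \<rho>' x y"
    and "\<And>x y. x \<in> \<Sigma> \<Longrightarrow> y \<noteq> x \<Longrightarrow> data_Ninf \<epsilon> f \<alpha> \<rho> x y = data_Ninf \<epsilon> f' \<alpha>' \<rho>' x y"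
  shows "\<forall>y. \<forall>v\<in>sphere 0 1. xray (\<lambda>z. \<epsilon> * \<alpha> z) y v = xray (\<lambda>z. \<epsilon> * \<alpha>' z) y v"
proof (intro allI ballI)
  fix y v :: "real^3" assume "v \<in> sphere 0 1"
  hence v: "norm v = 1" by simp
  note A = admissibleD[OF assms(5)] and A' = admissibleD[OF assms(6)]
  define K where "K = supp \<alpha> \<union> supp \<rho> \<union> supp \<alpha>' \<union> supp \<rho>'"
  have K: "compact K" "K \<subseteq> D"
    using compact_Un[OF A(8) A'(8)] A(6,7) A'(6,7) by (auto simp: K_def Un_assoc)
  have out: "\<alpha> z = 0" "\<alpha>' z = 0" if "z \<notin> K" for z
    using that by (auto simp: K_def not_in_supp)
  have agree: "seg_mean \<alpha> x z = seg_mean \<alpha>' x z"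
    if x: "x \<in> frontier D" and z: "z \<in> interior (supp f) \<or> z \<in> interior (supp f')" and zK: "z \<notin> K" for x z
  proof -
    have M: "data_M0 \<epsilon> f \<alpha> \<rho> x w = data_M0 \<epsilon> f' \<alpha>' \<rho>' x w"
      and N: "data_Ninf \<epsilon> f \<alpha> \<rho> x w = data_Ninf \<epsilon> f' \<alpha>' \<rho>' x w" if "w \<noteq> x" for w
      using assms(3,7,8) x that by auto
    show ?thesis
      using z
    proof
      assume "z \<in> interior (supp f)"
      thus ?thesis
        using zK by (intro seg_means_agree[OF assms(1,5,6,4) x M N]) (auto simp: K_def)
    next
      assume "z \<in> interior (supp f')"
      hence "seg_mean \<alpha>' x z = seg_mean \<alpha> x z"
        using zK by (intro seg_means_agree[OF assms(1,6,5,4) x M[symmetric] N[symmetric]]) (auto simp: K_def)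
      thus ?thesis by simp
    qed
  qed
  have "xray \<alpha> y v = xray \<alpha>' y v"
  proof (cases "\<exists>s. y + s *\<^sub>R v \<in> K")
    case False
    thus ?thesis by (simp add: xray_def out)
  next
    case True
    define S where "S = {s. y + s *\<^sub>R v \<in> K}"
    have "compact S" unfolding S_def by (rule compact_line_section[OF K(1) v])
    moreover have "S \<noteq> {}" using True by (auto simp: S_def)
    ultimately obtain s where s: "s \<in> S" "\<And>r. r \<in> S \<Longrightarrow> r \<le> s"
      using compact_attains_sup by metis
    \<comment> \<open>At the last point of the line in \<open>K\<close> one of the two sources has that point in the interior of
      its support; it does not matter which one.\<close>
    let ?W = "interior (supp f) \<union> interior (supp f')"
    show ?thesis
    proof (rule xray_eqI[OF assms(1,2) K v out])
      show "y + s *\<^sub>R v \<in> K" using s by (simp add: S_def)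
      show "y + s' *\<^sub>R v \<notin> K" if "s' > s" for s' using s(2)[of s'] that by (auto simp: S_def)
      show "open ?W" by auto
      show "y + s *\<^sub>R v \<in> ?W" using s(1) A(5) A'(5) by (auto simp: S_def K_def)
      show "seg_mean \<alpha> x z = seg_mean \<alpha>' x z" if "x \<in> frontier D" "z \<in> ?W" "z \<notin> K" for x z
        using agree that by auto
    qed
  qed
  thus "xray (\<lambda>z. \<epsilon> * \<alpha> z) y v = xray (\<lambda>z. \<epsilon> * \<alpha>' z) y v"
    by (simp add: xray_def)
qed

end
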